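(* Let $A$ be a unital C*-algebra and let $\{x_j : j\in\mathbb J\}$ be a standard frame of a finitely or countably generated Hilbert $A$-module $\mathcal H$. Then $\{x_j\}$ is the image of a standard normalized tight frame $\{y_j : j\in\mathbb J\}$ of $\mathcal H$ under an invertible adjointable bounded $A$-linear operator $T$ on $\mathcal H$; $T$ can be chosen positive and equal to $(\theta^*\theta)^{1/2}$, where $\theta$ is the frame transform of $\{x_j\}$. Conversely, the image of a standard normalized tight frame of $\mathcal H$ under an invertible adjointable bounded $A$-linear operator on $\mathcal H$ is a standard frame of $\mathcal H$. Moreover, every standard frame $\{x_j\}$ is a set of generators of $\mathcal H$ as a Hilbert $A$-module (its $A$-linear span is norm-dense).
   Context: A (left) Hilbert $A$-module is a left $A$-module $\mathcal H$ with an $A$-valued inner product $\langle\cdot,\cdot\rangle$, $A$-linear in the first argument, with $\langle x,y\rangle=\langle y,x\rangle^*$, $\langle x,x\rangle\ge0$ and $=0$ only for $x=0$, complete in $\|x\|=\|\langle x,x\rangle\|^{1/2}$. Finitely generated: every element is an $A$-linear combination of finitely many fixed elements; countably generated: some countable subset has norm-dense $A$-linear span. $l_2(A)$ is the Hilbert $A$-module of sequences $(a_j)$ in $A$ with $\sum_ja_ja_j^*$ norm-convergent, inner product $\sum_ja_jb_j^*$. A sequence $\{x_j:j\in\mathbb J\}$ ($\mathbb J$ finite or countable) is a frame if there are $C,D>0$ with $C\langle x,x\rangle\le\sum_j\langle x,x_j\rangle\langle x_j,x\rangle\le D\langle x,x\rangle$ for all $x$; normalized tight if $C=D=1$ works;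 standard if this series converges in norm for all $x$. The frame transform of a standard frame is $\theta:\mathcal H\to l_2(A)$, $\theta(x)=\{\langle x,x_j\rangle\}_{j}$ (it is adjointable). *)

theory Defs
  imports "HOL-Analysis.Analysis"
begin

class cstar_algebra = real_normed_algebra_1 + banach +
  fixes scaleC :: "complex \<Rightarrow> 'a \<Rightarrow> 'a"
    and cstar :: "'a \<Rightarrow> 'a"
  assumes scaleC_of_real: "scaleC (complex_of_real r) x = scaleR r x"
    and scaleC_add_right: "scaleC c (x + y) = scaleC c x + scaleC c y"
    and scaleC_add_left: "scaleC (c + d) x = scaleC c x + scaleC d x"
    and scaleC_scaleC: "scaleC c (scaleC d x) = scaleC (c * d) x"
    and norm_scaleC: "norm (scaleC c x) = cmod c * norm x"
    and scaleC_mult_left: "scaleC c x * y = scaleC c (x * y)"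
    and scaleC_mult_right: "x * scaleC c y = scaleC c (x * y)"
    and cstar_add: "cstar (x + y) = cstar x + cstar y"
    and cstar_scaleC: "cstar (scaleC c x) = scaleC (cnj c) (cstar x)"
    and cstar_mult: "cstar (x * y) = cstar y * cstar x"
    and cstar_cstar: "cstar (cstar x) = x"
    and cstar_identity: "norm (cstar x * x) = (norm x)\<^sup>2"

definition invertible_elem :: "'a::cstar_algebra \<Rightarrow> bool" where
  "invertible_elem a \<longleftrightarrow> (\<exists>b. a * b = 1 \<and> b * a = 1)"

definition spectrum_elem :: "'a::cstar_algebra \<Rightarrow> complex set" where
  "spectrum_elem a = {c. \<not> invertible_elem (a - scaleC c 1)}"

definition pos_elem :: "'a::cstar_algebra \<Rightarrow> bool" where
  "pos_elem a \<longleftrightarrow> cstar a = a \<and> (\<forall>c\<in>spectrum_elem a. Im c = 0 \<and> Re c \<ge> 0)"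

definition cle :: "'a::cstar_algebra \<Rightarrow> 'a \<Rightarrow> bool" where
  "cle a b \<longleftrightarrow> pos_elem (b - a)"

definition hnorm :: "('h \<Rightarrow> 'h \<Rightarrow> 'a::cstar_algebra) \<Rightarrow> 'h \<Rightarrow> real" where
  "hnorm ip x = sqrt (norm (ip x x))"

definition hilbert_module ::
  "('a::cstar_algebra \<Rightarrow> 'h::ab_group_add \<Rightarrow> 'h) \<Rightarrow> ('h \<Rightarrow> 'h \<Rightarrow> 'a) \<Rightarrow> bool" where
  "hilbert_module act ip \<longleftrightarrow>
     (\<forall>a b x. act (a * b) x = act a (act b x)) \<and>
     (\<forall>a b x. act (a + b) x = act a x + act b x) \<and>
     (\<forall>a x y. act a (x + y) = act a x + act a y) \<and>
     (\<forall>x. act 1 x = x) \<and>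
     (\<forall>a x y z. ip (act a x + y) z = a * ip x z + ip y z) \<and>
     (\<forall>x y. ip x y = cstar (ip y x)) \<and>
     (\<forall>x. pos_elem (ip x x)) \<and>
     (\<forall>x. ip x x = 0 \<longrightarrow> x = 0) \<and>
     (\<forall>X. (\<forall>e>0. \<exists>N. \<forall>m\<ge>N. \<forall>n\<ge>N. hnorm ip (X m - X n) < e) \<longrightarrow>
          (\<exists>L. (\<lambda>n. hnorm ip (X n - L)) \<longlonglongrightarrow> 0))"

definition alin_span :: "('a \<Rightarrow> 'h::ab_group_add \<Rightarrow> 'h) \<Rightarrow> 'h set \<Rightarrow> 'h set" where
  "alin_span act S = {(\<Sum>i\<in>F. act (c i) i) | F c. finite F \<and> F \<subseteq> S}"

definition finitely_generated ::
  "('a::cstar_algebra \<Rightarrow> 'h::ab_group_add \<Rightarrow> 'h) \<Rightarrow> bool" where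
  "finitely_generated act \<longleftrightarrow> (\<exists>S. finite S \<and> alin_span act S = UNIV)"

definition generates ::
  "('a::cstar_algebra \<Rightarrow> 'h::ab_group_add \<Rightarrow> 'h) \<Rightarrow> ('h \<Rightarrow> 'h \<Rightarrow> 'a) \<Rightarrow> 'h set \<Rightarrow> bool" where
  "generates act ip S \<longleftrightarrow>
     (\<forall>x. \<forall>e>0. \<exists>y\<in>alin_span act S. hnorm ip (x - y) < e)"

definition countably_generated ::
  "('a::cstar_algebra \<Rightarrow> 'h::ab_group_add \<Rightarrow> 'h) \<Rightarrow> ('h \<Rightarrow> 'h \<Rightarrow> 'a) \<Rightarrow> bool" where
  "countably_generated act ip \<longleftrightarrow> (\<exists>S. countable S \<and> generates act ip S)"

text \<open>Index sets \<open>\<JJ>\<close> are subsets \<open>J\<close> of \<open>nat\<close> (finite or countable); series over \<open>J\<close>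
are taken in the natural order, i.e. as limits of the partial sums over \<open>J \<inter> {..<n}\<close>.\<close>

definition jsums :: "nat set \<Rightarrow> (nat \<Rightarrow> 'a::real_normed_vector) \<Rightarrow> 'a \<Rightarrow> bool" where
  "jsums J f s \<longleftrightarrow> (\<lambda>n. \<Sum>j\<in>J \<inter> {..<n}. f j) \<longlonglongrightarrow> s"

definition standard_frame ::
  "('a::cstar_algebra \<Rightarrow> 'h::ab_group_add \<Rightarrow> 'h) \<Rightarrow> ('h \<Rightarrow> 'h \<Rightarrow> 'a) \<Rightarrow> nat set \<Rightarrow> (nat \<Rightarrow> 'h) \<Rightarrow> bool" where
  "standard_frame act ip J x \<longleftrightarrow>
     (\<exists>C D. C > 0 \<and> D > 0 \<and>
       (\<forall>v. \<exists>s. jsums J (\<lambda>j. ip v (x j) * ip (x j) v) s \<and>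
              cle (scaleR C (ip v v)) s \<and> cle s (scaleR D (ip v v))))"

definition standard_nt_frame ::
  "('a::cstar_algebra \<Rightarrow> 'h::ab_group_add \<Rightarrow> 'h) \<Rightarrow> ('h \<Rightarrow> 'h \<Rightarrow> 'a) \<Rightarrow> nat set \<Rightarrow> (nat \<Rightarrow> 'h) \<Rightarrow> bool" where
  "standard_nt_frame act ip J x \<longleftrightarrow>
     (\<forall>v. jsums J (\<lambda>j. ip v (x j) * ip (x j) v) (ip v v))"

definition alinear :: "('a \<Rightarrow> 'h::ab_group_add \<Rightarrow> 'h) \<Rightarrow> ('h \<Rightarrow> 'h) \<Rightarrow> bool" where
  "alinear act T \<longleftrightarrow> (\<forall>a x y. T (act a x + y) = act a (T x) + T y)"

definition bounded_op :: "('h \<Rightarrow> 'h \<Rightarrow> 'a::cstar_algebra) \<Rightarrow> ('h \<Rightarrow> 'h) \<Rightarrow> bool" where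
  "bounded_op ip T \<longleftrightarrow> (\<exists>K. \<forall>x. hnorm ip (T x) \<le> K * hnorm ip x)"

definition adjoint_of :: "('h \<Rightarrow> 'h \<Rightarrow> 'a) \<Rightarrow> ('h \<Rightarrow> 'h) \<Rightarrow> ('h \<Rightarrow> 'h) \<Rightarrow> bool" where
  "adjoint_of ip T S \<longleftrightarrow> (\<forall>x y. ip (T x) y = ip x (S y))"

definition adjointable :: "('h \<Rightarrow> 'h \<Rightarrow> 'a) \<Rightarrow> ('h \<Rightarrow> 'h) \<Rightarrow> bool" where
  "adjointable ip T \<longleftrightarrow> (\<exists>S. adjoint_of ip T S)"

definition good_op ::
  "('a::cstar_algebra \<Rightarrow> 'h::ab_group_add \<Rightarrow> 'h) \<Rightarrow> ('h \<Rightarrow> 'h \<Rightarrow> 'a) \<Rightarrow> ('h \<Rightarrow> 'h) \<Rightarrow> bool" where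
  "good_op act ip T \<longleftrightarrow> alinear act T \<and> bounded_op ip T \<and> adjointable ip T"

definition invertible_op ::
  "('a::cstar_algebra \<Rightarrow> 'h::ab_group_add \<Rightarrow> 'h) \<Rightarrow> ('h \<Rightarrow> 'h \<Rightarrow> 'a) \<Rightarrow> ('h \<Rightarrow> 'h) \<Rightarrow> bool" where
  "invertible_op act ip T \<longleftrightarrow> good_op act ip T \<and>
     (\<exists>S. good_op act ip S \<and> (\<forall>x. S (T x) = x) \<and> (\<forall>x. T (S x) = x))"

definition positive_op ::
  "('a::cstar_algebra \<Rightarrow> 'h::ab_group_add \<Rightarrow> 'h) \<Rightarrow> ('h \<Rightarrow> 'h \<Rightarrow> 'a) \<Rightarrow> ('h \<Rightarrow> 'h) \<Rightarrow> bool" where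
  "positive_op act ip T \<longleftrightarrow> good_op act ip T \<and> adjoint_of ip T T \<and> (\<forall>x. pos_elem (ip (T x) x))"

definition l2 :: "(nat \<Rightarrow> 'a::cstar_algebra) set" where
  "l2 = {a. convergent (\<lambda>n. \<Sum>j<n. a j * cstar (a j))}"

definition l2_ip :: "(nat \<Rightarrow> 'a::cstar_algebra) \<Rightarrow> (nat \<Rightarrow> 'a) \<Rightarrow> 'a" where
  "l2_ip a b = lim (\<lambda>n. \<Sum>j<n. a j * cstar (b j))"

definition frame_transform :: "('h \<Rightarrow> 'h \<Rightarrow> 'a::cstar_algebra) \<Rightarrow> nat set \<Rightarrow> (nat \<Rightarrow> 'h) \<Rightarrow> 'h \<Rightarrow> nat \<Rightarrow> 'a" where
  "frame_transform ip J x v = (\<lambda>j. if j \<in> J then ip v (x j) else 0)"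

definition is_transform_adjoint ::
  "('h \<Rightarrow> 'h \<Rightarrow> 'a::cstar_algebra) \<Rightarrow> nat set \<Rightarrow> (nat \<Rightarrow> 'h) \<Rightarrow> ((nat \<Rightarrow> 'a) \<Rightarrow> 'h) \<Rightarrow> bool" where
  "is_transform_adjoint ip J x S \<longleftrightarrow>
     (\<forall>v. \<forall>b\<in>l2. l2_ip (frame_transform ip J x v) b = ip v (S b))"

end

theory Submission
  imports Defs
begin

text \<open>The frame operator \<open>S = \<theta>\<^sup>*\<theta>\<close>, given by \<open>S v = \<Sum>\<^sub>j \<langle>v, x\<^sub>j\<rangle> x\<^sub>j\<close>, satisfies
  \<open>C \<langle>v,v\<rangle> \<le> \<langle>S v, v\<rangle> \<le> D \<langle>v,v\<rangle>\<close>, so \<open>S = M (1 - B)\<close> with \<open>M = C + D\<close> and \<open>B\<close> self-adjoint of norm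
  less than one. A fixed point iteration produces a self-adjoint strict contraction \<open>Y\<close> with
  \<open>(1 - Y)\<^sup>2 = 1 - B\<close>; then \<open>T = \<surd>M (1 - Y)\<close> is the positive invertible square root of \<open>S\<close>, and
  \<open>y\<^sub>j = T\<^sup>-\<^sup>1 x\<^sub>j\<close> is normalized tight because \<open>\<langle>S T\<^sup>-\<^sup>1 v, T\<^sup>-\<^sup>1 v\<rangle> = \<langle>v, v\<rangle>\<close>. Surjectivity of \<open>S\<close> gives
  density of the span.

  The order theory of a C*-algebra is obtained without functional calculus: \<open>1 - b\<close> has a
  self-adjoint square root for self-adjoint \<open>b\<close> of norm less than one, and for commuting
  self-adjoint \<open>a\<close>, \<open>b\<close> the element \<open>a + ib\<close> witnesses \<open>\<parallel>a\<parallel>\<^sup>2 \<le> \<parallel>a\<^sup>2 + b\<^sup>2\<parallel>\<close>. Together they put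
  \<open>\<parallel>h\<parallel>\<close> or \<open>-\<parallel>h\<parallel>\<close> into the spectrum of a self-adjoint \<open>h\<close>, so that a self-adjoint \<open>p\<close> is positive
  iff \<open>\<parallel>t - p\<parallel> \<le> t\<close> for some (equivalently, every) \<open>t \<ge> \<parallel>p\<parallel>\<close>.\<close>

section \<open>Square roots and spectra of self-adjoint elements\<close>

lemma cstar_scaleR: "cstar (r *\<^sub>R x) = r *\<^sub>R cstar (x::'a::cstar_algebra)"
  by (metis scaleC_of_real cstar_scaleC complex_cnj_complex_of_real)

lemma cstar_zero [simp]: "cstar 0 = (0::'a::cstar_algebra)"
  using cstar_add[of 0 "0::'a"] by simp

lemma cstar_minus: "cstar (- x) = - cstar (x::'a::cstar_algebra)"
  using cstar_scaleR[of "-1" x] by simp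

lemma cstar_diff: "cstar (x - y) = cstar x - cstar (y::'a::cstar_algebra)"
  using cstar_add[of x "-y"] by (simp add: cstar_minus)

lemma cstar_one [simp]: "cstar 1 = (1::'a::cstar_algebra)"
  by (metis cstar_cstar cstar_mult mult_1 mult_1_right)

lemma cstar_sum: "cstar (sum f F) = (\<Sum>i\<in>F. cstar (f i :: 'a::cstar_algebra))"
  by (induction F rule: infinite_finite_induct) (simp_all add: cstar_add)

lemma norm_cstar [simp]: "norm (cstar x) = norm (x::'a::cstar_algebra)"
proof -
  have le: "norm z \<le> norm (cstar z)" for z :: 'a
  proof (cases "z = 0")
    case False
    have "norm z * norm z \<le> norm (cstar z) * norm z"
      using norm_mult_ineq[of "cstar z" z] by (simp add: cstar_identity power2_eq_square)
    then show ?thesis using False by simp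
  qed simp
  show ?thesis using le[of x] le[of "cstar x"] by (simp add: cstar_cstar)
qed

lemma norm_mult_cstar: "norm (x * cstar x) = (norm (x::'a::cstar_algebra))\<^sup>2"
  using cstar_identity[of "cstar x"] by (simp add: cstar_cstar)

lemma bounded_linear_cstar: "bounded_linear (cstar :: 'a::cstar_algebra \<Rightarrow> 'a)"
  by (rule bounded_linear_intro[where K=1]) (simp_all add: cstar_add cstar_scaleR)

lemma scaleC_one: "scaleC 1 x = (x::'a::cstar_algebra)"
  using scaleC_of_real[of 1 x] by simp

lemma scaleC_minus_left: "scaleC (- c) x = - scaleC c (x::'a::cstar_algebra)"
proof -
  have "scaleC 0 x = 0" using scaleC_of_real[of 0 x] by simp
  then show ?thesis using scaleC_add_left[of "-c" c x] by (simp add: eq_neg_iff_add_eq_0)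
qed

lemma scaleC_minus_right: "scaleC c (- x) = - scaleC c (x::'a::cstar_algebra)"
proof -
  have "scaleC c (0::'a) = 0" using scaleC_add_right[of c 0 "0::'a"] by simp
  then show ?thesis using scaleC_add_right[of c "-x" x] by (simp add: eq_neg_iff_add_eq_0)
qed

lemma scaleC_diff_right: "scaleC c (x - y) = scaleC c x - scaleC c (y::'a::cstar_algebra)"
  using scaleC_add_right[of c x "-y"] by (simp add: scaleC_minus_right)

section \<open>Invertible elements and the Neumann series\<close>

lemma invertible_elem_commuting_factor:
  fixes x y :: "'a::cstar_algebra"
  assumes "invertible_elem (x * y)" "x * y = y * x"
  shows "invertible_elem x"
proof -
  obtain z where z: "x * y * z = 1" "z * (x * y) = 1"
    using assms(1) unfolding invertible_elem_def by blast
  have 1: "x * (y * z) = 1" using z(1) by (simp add: mult.assoc)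
  have 2: "(z * y) * x = 1" using z(2) assms(2) by (simp add: mult.assoc)
  have "z * y = y * z" using 1 2 by (metis mult.assoc mult_1 mult_1_right)
  then show ?thesis unfolding invertible_elem_def using 1 2 by metis
qed

lemma invertible_elem_scaleC:
  assumes "invertible_elem (x::'a::cstar_algebra)" "c \<noteq> 0"
  shows "invertible_elem (scaleC c x)"
proof -
  obtain z where "x * z = 1" "z * x = 1" using assms(1) unfolding invertible_elem_def by blast
  then show ?thesis unfolding invertible_elem_def
    by (intro exI[of _ "scaleC (1/c) z"])
      (simp add: scaleC_mult_left scaleC_mult_right scaleC_scaleC scaleC_one assms(2))
qed

lemma invertible_elem_scaleR:
  assumes "invertible_elem (x::'a::cstar_algebra)" "r \<noteq> 0"
  shows "invertible_elem (r *\<^sub>R x)"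
  using invertible_elem_scaleC[OF assms(1), of "complex_of_real r"] assms(2)
  by (simp add: scaleC_of_real)

lemma commute_inverse:
  fixes x y z :: "'a::cstar_algebra"
  assumes "x * z = 1" "z * x = 1" "x * y = y * x"
  shows "z * y = y * z"
proof -
  have "z * y = z * (y * x) * z" using assms(1) by (simp add: mult.assoc)
  also have "\<dots> = z * x * y * z" using assms(3) by (simp add: mult.assoc)
  also have "\<dots> = y * z" using assms(2) by simp
  finally show ?thesis .
qed

lemma neumann:
  fixes x :: "'a::cstar_algebra"
  assumes "norm x < 1"
  shows "\<exists>y. (1 - x) * y = 1 \<and> y * (1 - x) = 1"
proof -
  have s: "summable (\<lambda>n. x ^ n)"
  proof (rule summable_comparison_test')
    show "summable (\<lambda>n. norm x ^ n)" using assms by (simp add: summable_geometric)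
    show "norm (x ^ n) \<le> norm x ^ n" for n by (rule norm_power_ineq)
  qed
  let ?y = "\<Sum>n. x ^ n"
  have e: "?y = 1 + (\<Sum>n. x ^ Suc n)" using suminf_split_head[OF s] by simp
  have 1: "(\<Sum>n. x ^ Suc n) = x * ?y" using suminf_mult[OF s, of x] by simp
  have 2: "(\<Sum>n. x ^ Suc n) = ?y * x" using suminf_mult2[OF s, of x] by (simp add: power_commutes)
  show ?thesis
    by (intro exI[of _ ?y] conjI) (use e 1 2 in \<open>simp_all add: algebra_simps\<close>)
qed

lemma neumann_half:
  fixes x :: "'a::cstar_algebra"
  assumes "norm x \<le> 1/2"
  shows "\<exists>y. (1 - x) * y = 1 \<and> y * (1 - x) = 1 \<and> norm y \<le> 2"
proof -
  obtain y where y: "(1 - x) * y = 1" "y * (1 - x) = 1" using neumann[of x] assms by auto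
  have "y = 1 + x * y" using y(1) by (simp add: algebra_simps)
  then have "norm y \<le> 1 + norm (x * y)" by (metis norm_one norm_triangle_ineq)
  also have "norm (x * y) \<le> 1/2 * norm y"
    using norm_mult_ineq[of x y] mult_right_mono[OF assms, of "norm y"] by simp
  finally show ?thesis using y by auto
qed

lemma invertible_elem_near_scalar:
  fixes x :: "'a::cstar_algebra"
  assumes "norm x < cmod c"
  shows "invertible_elem (x - scaleC c 1)"
proof -
  have c: "c \<noteq> 0" using assms by auto
  have "norm (scaleC (1/c) x) < 1" using assms c by (simp add: norm_scaleC norm_divide divide_simps)
  then have "invertible_elem (1 - scaleC (1/c) x)" using neumann unfolding invertible_elem_def by blast
  then have "invertible_elem (scaleC (-c) (1 + scaleC (-(1/c)) x))"
    using c by (intro invertible_elem_scaleC) (simp_all add: scaleC_minus_left)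
  moreover have "scaleC (-c) (1 + scaleC (-(1/c)) x) = x - scaleC c 1"
    using c by (simp add: scaleC_diff_right scaleC_scaleC scaleC_one scaleC_minus_left)
  ultimately show ?thesis by simp
qed

lemma norm_spectrum: "c \<in> spectrum_elem (x::'a::cstar_algebra) \<Longrightarrow> cmod c \<le> norm x"
  using invertible_elem_near_scalar[of x c] unfolding spectrum_elem_def by force

section \<open>Square roots by the binomial series\<close>

lemma abs_half_gchoose_le_1: "\<bar>(1/2::real) gchoose n\<bar> \<le> 1"
proof (induction n)
  case (Suc n)
  have "real (Suc n) * ((1/2::real) gchoose Suc n) = (1/2 - real n) * ((1/2) gchoose n)"
    using gbinomial_mult_1[of "1/2::real" n] by (simp add: algebra_simps)
  then have "real (Suc n) * \<bar>(1/2::real) gchoose Suc n\<bar> = \<bar>1/2 - real n\<bar> * \<bar>(1/2) gchoose n\<bar>"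
    by (metis abs_mult abs_of_nat)
  also have "\<dots> \<le> real (Suc n) * 1" using Suc by (intro mult_mono) auto
  finally show ?case by simp
qed simp

text \<open>Binomial series of exponent 1/2, dominated by the geometric series in
  \<open>norm b\<close>. The commutation clause allows roots of different elements to be multiplied
  later.\<close>

lemma sqrt_one_minus:
  fixes b :: "'a::cstar_algebra"
  assumes sa: "cstar b = b" and nb: "norm b < 1"
  shows "\<exists>r. cstar r = r \<and> r * r = 1 - b \<and> (\<forall>x. x * b = b * x \<longrightarrow> x * r = r * x)"
proof -
  define g where "g n = ((1/2::real) gchoose n) * (-1) ^ n" for n
  define f where "f n = g n *\<^sub>R b ^ n" for n
  have ns: "summable (\<lambda>n. norm (f n))"
  proof (rule summable_comparison_test')
    show "summable (\<lambda>n. norm b ^ n)" using nb by (simp add: summable_geometric)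
    fix n
    have "norm (f n) \<le> 1 * norm (b ^ n)"
      unfolding f_def g_def using abs_half_gchoose_le_1[of n]
      by (simp only: norm_scaleR abs_mult power_abs) (simp add: mult_left_le_one_le)
    then show "norm (norm (f n)) \<le> norm b ^ n" using norm_power_ineq[of b n] by simp
  qed
  then have s: "summable f" by (rule summable_norm_cancel)
  let ?r = "suminf f"
  have sa_pow: "cstar (b ^ n) = b ^ n" for n
    by (induction n) (simp_all add: cstar_mult sa power_commutes)
  have "cstar ?r = (\<Sum>n. cstar (f n))"
    using bounded_linear.suminf[OF bounded_linear_cstar s] by simp
  also have "\<dots> = ?r" unfolding f_def by (simp add: cstar_scaleR sa_pow)
  finally have 1: "cstar ?r = ?r" .
  \<comment> \<open>By Vandermonde's identity the Cauchy square of the series has coefficients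
    \<open>1 gchoose k\<close>, which vanish from \<open>k = 2\<close> on.\<close>
  have coeff: "(\<Sum>i\<le>k. f i * f (k - i)) = (((1::real) gchoose k) * (-1) ^ k) *\<^sub>R b ^ k" for k
  proof -
    have "(\<Sum>i\<le>k. f i * f (k - i)) =
        (\<Sum>i\<le>k. (((1/2::real) gchoose i) * ((1/2) gchoose (k - i)) * (-1) ^ k) *\<^sub>R b ^ k)"
    proof (intro sum.cong refl)
      fix i assume "i \<in> {..k}"
      then have "b ^ i * b ^ (k - i) = b ^ k" "(-1::real) ^ i * (-1) ^ (k - i) = (-1) ^ k"
        by (simp_all flip: power_add)
      moreover have "f i * f (k - i) = (((1/2::real) gchoose i) * ((1/2) gchoose (k - i)) *
          ((-1) ^ i * (-1) ^ (k - i))) *\<^sub>R (b ^ i * b ^ (k - i))"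
        unfolding f_def g_def by (simp only: mult_scaleR_left mult_scaleR_right scaleR_scaleR mult_ac)
      ultimately show "f i * f (k - i) =
          (((1/2::real) gchoose i) * ((1/2) gchoose (k - i)) * (-1) ^ k) *\<^sub>R b ^ k"
        by (simp only:)
    qed
    also have "\<dots> = ((\<Sum>i\<le>k. ((1/2::real) gchoose i) * ((1/2) gchoose (k - i))) * (-1) ^ k) *\<^sub>R b ^ k"
      by (simp add: scaleR_left.sum sum_distrib_right)
    also have "(\<Sum>i\<le>k. ((1/2::real) gchoose i) * ((1/2) gchoose (k - i))) = (1 gchoose k)"
      using gbinomial_Vandermonde[of "1/2::real" "1/2" k] by (simp add: atMost_atLeast0)
    finally show ?thesis .
  qed
  have "?r * ?r = (\<Sum>k. \<Sum>i\<le>k. f i * f (k - i))" by (rule Cauchy_product[OF ns ns])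
  also have "\<dots> = (\<Sum>k. (((1::real) gchoose k) * (-1) ^ k) *\<^sub>R b ^ k)" by (simp only: coeff)
  also have "\<dots> = (\<Sum>k\<in>{..<2}. (((1::real) gchoose k) * (-1) ^ k) *\<^sub>R b ^ k)"
  proof (intro suminf_finite)
    fix k :: nat assume "k \<notin> {..<2}"
    then have "1 choose k = 0" by (simp add: binomial_eq_0)
    then have "(1::real) gchoose k = 0" using binomial_gbinomial[of 1 k, where ?'a=real] by (metis of_nat_0 of_nat_1)
    then show "(((1::real) gchoose k) * (-1) ^ k) *\<^sub>R b ^ k = 0" by simp
  qed simp
  also have "\<dots> = 1 - b" by (simp add: eval_nat_numeral)
  finally have 2: "?r * ?r = 1 - b" .
  have 3: "x * ?r = ?r * x" if "x * b = b * x" for x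
  proof -
    have "x * b ^ n = b ^ n * x" for n
      using power_commuting_commutes[of b x n] that by simp
    then show ?thesis
      using suminf_mult[OF s, of x] suminf_mult2[OF s, of x] by (simp add: f_def)
  qed
  show ?thesis using 1 2 3 by blast
qed

text \<open>\<open>a\<close> is the real part of \<open>z = a + ib\<close>, so
  \<open>norm a \<le> norm z\<close>; commutation cancels the cross terms of
  \<open>cstar z * z\<close>.\<close>

lemma norm_sq_le_norm_sum_squares:
  fixes a b :: "'a::cstar_algebra"
  assumes "cstar a = a" "cstar b = b" "a * b = b * a"
  shows "(norm a)\<^sup>2 \<le> norm (a * a + b * b)"
proof -
  define z where "z = a + scaleC \<i> b"
  have cz: "cstar z = a - scaleC \<i> b"
    unfolding z_def by (simp add: cstar_add cstar_scaleC assms scaleC_minus_left)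
  have "cstar z * z = a * a + b * b"
    unfolding cz unfolding z_def
    by (simp add: algebra_simps scaleC_mult_left scaleC_mult_right scaleC_scaleC assms(3)
        scaleC_minus_left scaleC_diff_right scaleC_one)
  then have nz: "(norm z)\<^sup>2 = norm (a * a + b * b)" by (metis cstar_identity)
  have "2 *\<^sub>R a = z + cstar z" by (simp add: cz) (simp add: z_def scaleR_2)
  then have "2 * norm a \<le> norm z + norm (cstar z)"
    by (metis norm_scaleR norm_triangle_ineq abs_numeral)
  then have "norm a \<le> norm z" by simp
  then show ?thesis using nz by (metis norm_ge_zero power_mono)
qed

lemma sqrt_scalar_minus:
  fixes b :: "'a::cstar_algebra"
  assumes sa: "cstar b = b" and nb: "norm b < t"
  shows "\<exists>r. cstar r = r \<and> r * r = t *\<^sub>R 1 - b \<and> (\<forall>x. x * b = b * x \<longrightarrow> x * r = r * x)"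
proof -
  have t: "t > 0" using nb norm_ge_zero[of b] by linarith
  define c where "c = (1/t) *\<^sub>R b"
  have "cstar c = c" "norm c < 1" unfolding c_def using sa nb t by (simp_all add: cstar_scaleR)
  then obtain r where r: "cstar r = r" "r * r = 1 - c" "\<And>x. x * c = c * x \<Longrightarrow> x * r = r * x"
    using sqrt_one_minus by metis
  have b: "b = t *\<^sub>R c" unfolding c_def using t by simp
  have "x * (sqrt t *\<^sub>R r) = sqrt t *\<^sub>R r * x" if "x * b = b * x" for x
    using r(3)[of x] that by (simp add: c_def)
  moreover have "cstar (sqrt t *\<^sub>R r) = sqrt t *\<^sub>R r" by (simp add: cstar_scaleR r(1))
  moreover have "sqrt t *\<^sub>R r * (sqrt t *\<^sub>R r) = t *\<^sub>R 1 - b"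
    unfolding b using t by (simp add: r(2) scaleR_diff_right)
  ultimately show ?thesis by blast
qed

text \<open>For a root \<open>u\<close> of \<open>s - h * h\<close>, the square of
  \<open>norm u\<close> is at most the norm of \<open>u * u + h * h\<close>, which is the scalar
  \<open>s\<close>. This is the norm form of the positivity of \<open>h * h\<close>.\<close>

lemma norm_scalar_minus_square:
  fixes h :: "'a::cstar_algebra"
  assumes sa: "cstar h = h" and t: "(norm h)\<^sup>2 \<le> t"
  shows "norm (t *\<^sub>R 1 - h * h) \<le> t"
proof (rule field_le_epsilon)
  fix e :: real assume e: "e > 0"
  \<comment> \<open>The root requires a strict inequality, so \<open>t\<close> is enlarged slightly;
    the excess vanishes with \<open>e\<close>.\<close>
  define s where "s = t + e / 2"
  have "norm (h * h) < s"
    using norm_mult_ineq[of h h] t e unfolding s_def power2_eq_square by linarith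
  then obtain u where u: "cstar u = u" "u * u = s *\<^sub>R 1 - h * h" "h * u = u * h"
    using sqrt_scalar_minus[of "h * h" s] sa by (auto simp: cstar_mult mult.assoc)
  have s0: "s > 0" using t e zero_le_power2[of "norm h"] unfolding s_def by linarith
  have "norm (s *\<^sub>R 1 - h * h) \<le> (norm u)\<^sup>2"
    using norm_mult_ineq[of u u] u by (simp add: power2_eq_square)
  also have "\<dots> \<le> norm (u * u + h * h)"
    using norm_sq_le_norm_sum_squares[of u h] u sa by simp
  also have "\<dots> = s" using u s0 by simp
  finally have 1: "norm (s *\<^sub>R 1 - h * h) \<le> s" .
  have "norm (t *\<^sub>R 1 - h * h) = norm ((s *\<^sub>R 1 - h * h) - (e/2) *\<^sub>R 1)"
    unfolding s_def by (simp add: algebra_simps)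
  also have "\<dots> \<le> norm (s *\<^sub>R 1 - h * h) + norm ((e/2) *\<^sub>R 1 :: 'a)" by (rule norm_triangle_ineq4)
  also have "\<dots> \<le> s + e / 2" using 1 e by simp
  finally show "norm (t *\<^sub>R 1 - h * h) \<le> t + e" unfolding s_def by simp
qed

text \<open>Rescaling reduces \<open>c\<close> to the imaginary unit \<open>j\<close>. Then
  \<open>k - j\<close> divides \<open>k * k + 1\<close>, which differs from the scalar
  \<open>K + 1\<close> by an element of norm at most \<open>K\<close>.\<close>

lemma invertible_elem_self_adjoint_nonreal:
  fixes h :: "'a::cstar_algebra"
  assumes sa: "cstar h = h" and c: "Im c \<noteq> 0"
  shows "invertible_elem (h - scaleC c 1)"
proof -
  define k where "k = (1 / Im c) *\<^sub>R (h - Re c *\<^sub>R 1)"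
  have sak: "cstar k = k" unfolding k_def by (simp add: cstar_scaleR cstar_diff sa)
  define j :: 'a where "j = scaleC \<i> 1"
  have jj: "j * j = - 1" and jk: "j * k = k * j"
    unfolding j_def
    by (simp_all add: scaleC_mult_left scaleC_mult_right scaleC_scaleC scaleC_minus_left scaleC_one)
  define K where "K = (norm k)\<^sup>2"
  have "norm (K *\<^sub>R 1 - k * k) < cmod (of_real (K + 1))"
    using norm_scalar_minus_square[OF sak, of K] unfolding K_def
    by (simp only: norm_of_real) linarith
  from invertible_elem_near_scalar[OF this]
  have "invertible_elem (- (k * k + 1))"
    by (simp only: scaleC_of_real) (simp add: algebra_simps)
  then have "invertible_elem (k * k + 1)" using invertible_elem_scaleR[of "- (k * k + 1)" "-1"]
    by (simp only: scaleR_minus1_left minus_minus)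
  moreover have "(k - j) * (k + j) = k * k + 1" "(k + j) * (k - j) = k * k + 1"
    using jj jk by (simp_all add: algebra_simps)
  ultimately have "invertible_elem (k - j)"
    by (metis invertible_elem_commuting_factor)
  then have "invertible_elem (Im c *\<^sub>R (k - j))" using c by (rule invertible_elem_scaleR)
  moreover have "Im c *\<^sub>R (k - j) = h - scaleC c 1"
  proof -
    have "scaleC c (1::'a) = scaleC (of_real (Re c) + of_real (Im c) * \<i>) 1"
      by (rule arg_cong[where f = "\<lambda>z. scaleC z 1"]) (simp add: complex_eq_iff)
    also have "\<dots> = Re c *\<^sub>R 1 + Im c *\<^sub>R j"
      unfolding j_def by (simp only: scaleC_add_left scaleC_scaleC[symmetric] scaleC_of_real)
    finally show ?thesis unfolding k_def using c by (simp add: scaleR_diff_right)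
  qed
  ultimately show ?thesis by simp
qed

section \<open>The positive cone\<close>

lemma cstar_inverse:
  fixes x y :: "'a::cstar_algebra"
  assumes "x * y = 1" "y * x = 1" "cstar x = x"
  shows "cstar y = y"
proof -
  have "cstar y * x = 1" using arg_cong[OF assms(1), of cstar] assms(3) by (simp add: cstar_mult)
  then have "cstar y * (x * y) = y" by (simp add: mult.assoc[symmetric])
  then show ?thesis using assms(1) by simp
qed

lemma commute_mult:
  fixes x y z :: "'a::semigroup_mult"
  assumes "x * y = y * x" "x * z = z * x"
  shows "x * (y * z) = y * z * x"
proof -
  have "x * (y * z) = y * (x * z)" using assms(1) by (simp add: mult.assoc[symmetric])
  then show ?thesis using assms(2) by (simp add: mult.assoc)
qed

lemma commute_mult_self:
  fixes x y :: "'a::semigroup_mult"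
  assumes "x * y = y * x"
  shows "x * y * (x * y) = x * x * (y * y)"
proof -
  have "x * y * (x * y) = x * (y * x) * y" by (simp only: mult.assoc)
  also have "\<dots> = x * (x * y) * y" by (simp only: assms)
  finally show ?thesis by (simp only: mult.assoc)
qed

text \<open>If \<open>\<parallel>h\<parallel>\<^sup>2 - h\<^sup>2\<close> were invertible, then \<open>r - h\<^sup>2\<close> would still be the square of a self-adjoint
  element for some \<open>r < \<parallel>h\<parallel>\<^sup>2\<close>, whence \<open>\<parallel>h\<parallel>\<^sup>2 \<le> \<parallel>h\<^sup>2 + (r - h\<^sup>2)\<parallel> = r\<close>.\<close>

lemma norm_square_not_invertible:
  fixes h :: "'a::cstar_algebra"
  assumes sa: "cstar h = h" and h0: "h \<noteq> 0"
  shows "\<not> invertible_elem ((norm h)\<^sup>2 *\<^sub>R 1 - h * h)"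
proof
  define N where "N = (norm h)\<^sup>2"
  have N0: "N > 0" unfolding N_def using h0 by simp
  define k where "k = h * h"
  assume "invertible_elem ((norm h)\<^sup>2 *\<^sub>R 1 - h * h)"
  then obtain g where g: "(N *\<^sub>R 1 - k) * g = 1" "g * (N *\<^sub>R 1 - k) = 1"
    unfolding N_def k_def invertible_elem_def by blast
  have sak: "cstar k = k" unfolding k_def by (simp add: cstar_mult sa)
  have sag: "cstar g = g" using cstar_inverse[OF g] sak by (simp add: cstar_diff cstar_scaleR)
  have hk: "h * k = k * h" unfolding k_def by (simp add: mult.assoc)
  have hg: "g * h = h * g"
    by (rule commute_inverse[OF g]) (use hk in \<open>simp add: algebra_simps\<close>)
  have kg: "g * k = k * g" unfolding k_def by (rule commute_mult[OF hg hg])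
  define M where "M = norm g + 1"
  have M0: "M > 0" "norm g \<le> M" unfolding M_def using norm_ge_zero[of g] by linarith+
  \<comment> \<open>The bound \<open>1 / (4 * M)\<close> keeps the norm of \<open>e\<close> times
    \<open>gt\<close>, the inverse of \<open>t - k\<close> below, under one, so that the second root
    exists; the bound \<open>N\<close> keeps the final scalar \<open>t - e\<close> positive.\<close>
  define e where "e = min (1 / (4 * M)) N"
  have e: "e > 0" "e \<le> 1 / (4 * M)" "e \<le> N" unfolding e_def using M0 N0 by auto
  have eM: "e * M \<le> 1/4" using e(2) M0 by (simp add: field_simps)
  define d where "d = e / 2"
  have d: "d > 0" "d < e" unfolding d_def using e by auto
  have dg: "norm (- (d *\<^sub>R g)) \<le> 1/2"
  proof -
    have "d * norm g \<le> e * M" using d e M0 by (intro mult_mono) auto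
    then show ?thesis using d eM by simp
  qed
  obtain w where w: "(1 + d *\<^sub>R g) * w = 1" "w * (1 + d *\<^sub>R g) = 1" "norm w \<le> 2"
    using neumann_half[OF dg] by auto
  have saw: "cstar w = w" using cstar_inverse[OF w(1,2)] sag by (simp add: cstar_add cstar_scaleR)
  have wg: "w * g = g * w" by (rule commute_inverse[OF w(1,2)]) (simp add: algebra_simps)
  have wh: "w * h = h * w" by (rule commute_inverse[OF w(1,2)]) (use hg in \<open>simp add: algebra_simps\<close>)
  define gt where "gt = g * w"
  have sagt: "cstar gt = gt" unfolding gt_def by (simp add: cstar_mult sag saw wg)
  have hgt: "h * gt = gt * h" unfolding gt_def by (rule commute_mult[OF hg[symmetric] wh[symmetric]])
  \<comment> \<open>As \<open>d\<close> is half of \<open>e\<close>, \<open>t\<close> lies above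
    \<open>norm k\<close>, whereas \<open>t - e = N - d\<close> lies below \<open>N\<close>.\<close>
  define t where "t = N + d"
  have split: "t *\<^sub>R 1 - k = (N *\<^sub>R 1 - k) * (1 + d *\<^sub>R g)"
    unfolding t_def using g(1) by (simp add: distrib_left scaleR_add_left)
  have tg: "(t *\<^sub>R 1 - k) * gt = 1"
  proof -
    have "(t *\<^sub>R 1 - k) * gt = (N *\<^sub>R 1 - k) * ((1 + d *\<^sub>R g) * w) * g"
      unfolding split gt_def wg[symmetric] by (simp only: mult.assoc)
    then show ?thesis using w(1) g(1) by simp
  qed
  have ngt: "norm (e *\<^sub>R gt) < 1"
  proof -
    have "norm gt \<le> norm g * norm w" unfolding gt_def by (rule norm_mult_ineq)
    also have "\<dots> \<le> M * 2" using M0 w(3) by (intro mult_mono) auto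
    finally have "norm gt \<le> M * 2" .
    then have "e * norm gt \<le> e * (M * 2)" using e(1) by (intro mult_left_mono) auto
    moreover have "e * (M * 2) < 1" using eM by simp
    ultimately have "e * norm gt < 1" by (rule order.strict_trans1)
    then show ?thesis using e(1) by simp
  qed
  have "norm k < t"
    using norm_mult_ineq[of h h] d(1) unfolding t_def k_def N_def power2_eq_square by linarith
  then obtain u where u: "cstar u = u" "u * u = t *\<^sub>R 1 - k" "\<And>x. x * k = k * x \<Longrightarrow> x * u = u * x"
    using sqrt_scalar_minus[OF sak] by blast
  have saegt: "cstar (e *\<^sub>R gt) = e *\<^sub>R gt" by (simp only: cstar_scaleR sagt)
  obtain z where z: "cstar z = z" "z * z = 1 - e *\<^sub>R gt"
      "\<And>x. x * (e *\<^sub>R gt) = (e *\<^sub>R gt) * x \<Longrightarrow> x * z = z * x"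
    using sqrt_one_minus[OF saegt ngt] by blast
  have hu: "h * u = u * h" by (rule u(3)[OF hk])
  have hz: "h * z = z * h" by (rule z(3)) (simp only: hgt mult_scaleR_left mult_scaleR_right)
  have zk: "z * k = k * z" unfolding k_def by (rule commute_mult[OF hz[symmetric] hz[symmetric]])
  have uz: "u * z = z * u" using u(3)[OF zk] by (rule sym)
  have sauz: "cstar (u * z) = u * z" by (simp only: cstar_mult u(1) z(1) uz)
  have huz: "h * (u * z) = u * z * h" by (rule commute_mult[OF hu hz])
  \<comment> \<open>Since \<open>gt\<close> inverts \<open>t - k\<close>, multiplying
    \<open>t - k\<close> by \<open>1 - e gt\<close> collapses to \<open>t - e - k\<close>.\<close>
  have "u * z * (u * z) = (u * u) * (z * z)" by (rule commute_mult_self[OF uz])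
  also have "\<dots> = (t *\<^sub>R 1 - k) - e *\<^sub>R ((t *\<^sub>R 1 - k) * gt)"
    unfolding u(2) z(2) by (simp add: right_diff_distrib)
  also have "\<dots> = (t - e) *\<^sub>R 1 - k" unfolding tg by (simp add: scaleR_diff_left)
  finally have "h * h + u * z * (u * z) = (t - e) *\<^sub>R 1" unfolding k_def by simp
  then have "N \<le> norm ((t - e) *\<^sub>R 1 :: 'a)"
    using norm_sq_le_norm_sum_squares[OF sa sauz huz] unfolding N_def by simp
  then show False using d e(3) N0 unfolding t_def by simp
qed

text \<open>Inverses of both \<open>h - norm h\<close> and \<open>h + norm h\<close> would invert
  their product, which is \<open>h * h\<close> minus the squared norm.\<close>

lemma norm_in_spectrum:
  fixes h :: "'a::cstar_algebra"
  assumes sa: "cstar h = h" and "h \<noteq> 0"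
  shows "of_real (norm h) \<in> spectrum_elem h \<or> of_real (- norm h) \<in> spectrum_elem h"
proof (rule ccontr)
  let ?n = "norm h"
  assume "\<not> ?thesis"
  then have "invertible_elem (h - ?n *\<^sub>R 1)" "invertible_elem (h + ?n *\<^sub>R 1)"
    unfolding spectrum_elem_def mem_Collect_eq not_not de_Morgan_disj
    by (simp_all only: scaleC_of_real) simp_all
  then obtain a b where a: "(h - ?n *\<^sub>R 1) * a = 1" "a * (h - ?n *\<^sub>R 1) = 1"
    and b: "(h + ?n *\<^sub>R 1) * b = 1" "b * (h + ?n *\<^sub>R 1) = 1"
    unfolding invertible_elem_def by blast
  have e1: "?n\<^sup>2 *\<^sub>R 1 - h * h = - ((h - ?n *\<^sub>R 1) * (h + ?n *\<^sub>R 1))"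
    by (simp add: algebra_simps power2_eq_square)
  have "(?n\<^sup>2 *\<^sub>R 1 - h * h) * - (b * a) = (h - ?n *\<^sub>R 1) * ((h + ?n *\<^sub>R 1) * b) * a"
    unfolding e1 by (simp add: mult.assoc)
  moreover have "- (b * a) * (?n\<^sup>2 *\<^sub>R 1 - h * h) = b * (a * (h - ?n *\<^sub>R 1)) * (h + ?n *\<^sub>R 1)"
    unfolding e1 by (simp add: mult.assoc)
  ultimately have "invertible_elem (?n\<^sup>2 *\<^sub>R 1 - h * h)"
    unfolding invertible_elem_def using a b by (intro exI[of _ "- (b * a)"]) simp
  then show False using norm_square_not_invertible[OF assms] by blast
qed

section \<open>Positivity as a norm inequality\<close>

lemma spectrum_scalar_minus:
  "c \<in> spectrum_elem (x::'a::cstar_algebra) \<longleftrightarrow> of_real t - c \<in> spectrum_elem (t *\<^sub>R 1 - x)"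
proof -
  have e: "t *\<^sub>R 1 - x - scaleC (of_real t - c) 1 = - (x - scaleC c 1)"
    using scaleC_add_left[of "of_real t" "- c" "1::'a"]
    by (simp add: scaleC_of_real scaleC_minus_left)
  have "invertible_elem (- y) \<longleftrightarrow> invertible_elem y" for y :: 'a
    using invertible_elem_scaleR[of y "-1"] invertible_elem_scaleR[of "- y" "-1"] by auto
  then show ?thesis unfolding spectrum_elem_def mem_Collect_eq e by (simp only:)
qed

lemma pos_elem_self_adjoint: "pos_elem p \<Longrightarrow> cstar p = p"
  by (simp add: pos_elem_def)

lemma spectrum_self_adjoint_real:
  "cstar (h::'a::cstar_algebra) = h \<Longrightarrow> c \<in> spectrum_elem h \<Longrightarrow> Im c = 0"
  using invertible_elem_self_adjoint_nonreal[of h c] unfolding spectrum_elem_def by blast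

text \<open>The spectrum of \<open>t - p\<close> lies in the disc of radius \<open>t\<close>, so a
  real spectral value \<open>c\<close> of \<open>p\<close> satisfies \<open>t - c \<le> t\<close>.
  Together with \<open>pos_elemD\<close> this trades the spectral definition for a norm inequality
  that survives sums and limits.\<close>

lemma pos_elemI:
  fixes p :: "'a::cstar_algebra"
  assumes sa: "cstar p = p" and t: "norm (t *\<^sub>R 1 - p) \<le> t"
  shows "pos_elem p"
  unfolding pos_elem_def
proof (intro conjI ballI sa)
  fix c assume c: "c \<in> spectrum_elem p"
  show im: "Im c = 0" using spectrum_self_adjoint_real[OF sa c] .
  have "cmod (of_real t - c) \<le> t"
    using norm_spectrum[of "of_real t - c" "t *\<^sub>R 1 - p"] c t spectrum_scalar_minus[of c p t] by simp
  then show "Re c \<ge> 0" using complex_Re_le_cmod[of "of_real t - c"] by simp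
qed

text \<open>One of \<open>norm h\<close>, \<open>- norm h\<close> is a spectral value of
  \<open>h = t - p\<close>. The first puts \<open>t - norm h\<close> into the spectrum of
  \<open>p\<close>, so it is nonnegative; the second puts \<open>t + norm h\<close> there,
  contradicting \<open>norm p \<le> t\<close> unless \<open>h = 0\<close>.\<close>

lemma pos_elemD:
  fixes p :: "'a::cstar_algebra"
  assumes p: "pos_elem p" and t: "norm p \<le> t"
  shows "norm (t *\<^sub>R 1 - p) \<le> t"
proof (cases "t *\<^sub>R 1 - p = 0")
  case True
  then show ?thesis using t norm_ge_zero[of p] by (metis norm_zero order_trans)
next
  case False
  let ?h = "t *\<^sub>R 1 - p"
  have sa: "cstar ?h = ?h" using pos_elem_self_adjoint[OF p] by (simp add: cstar_diff cstar_scaleR)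
  from norm_in_spectrum[OF sa False] show ?thesis
  proof
    assume "of_real (norm ?h) \<in> spectrum_elem ?h"
    then have "of_real (t - norm ?h) \<in> spectrum_elem p"
      using spectrum_scalar_minus[of "of_real (t - norm ?h)" p t] by simp
    then show ?thesis using p unfolding pos_elem_def by force
  next
    assume "of_real (- norm ?h) \<in> spectrum_elem ?h"
    then have "of_real (t + norm ?h) \<in> spectrum_elem p"
      using spectrum_scalar_minus[of "of_real (t + norm ?h)" p t] by simp
    from norm_spectrum[OF this] show ?thesis using t norm_ge_zero[of ?h] norm_ge_zero[of p]
      by (simp only: norm_of_real)
  qed
qed

section \<open>Closure properties of the cone and monotonicity of the norm\<close>

lemma pos_elem_add:
  assumes "pos_elem (p::'a::cstar_algebra)" "pos_elem q"
  shows "pos_elem (p + q)"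
proof (rule pos_elemI)
  show "cstar (p + q) = p + q" using assms by (simp add: cstar_add pos_elem_self_adjoint)
  have "norm ((norm p + norm q) *\<^sub>R 1 - (p + q)) = norm ((norm p *\<^sub>R 1 - p) + (norm q *\<^sub>R 1 - q))"
    by (simp add: algebra_simps)
  also have "\<dots> \<le> norm (norm p *\<^sub>R 1 - p) + norm (norm q *\<^sub>R 1 - q)" by (rule norm_triangle_ineq)
  also have "\<dots> \<le> norm p + norm q" using pos_elemD assms by (intro add_mono) auto
  finally show "norm ((norm p + norm q) *\<^sub>R 1 - (p + q)) \<le> norm p + norm q" .
qed

lemma pos_elem_0 [simp]: "pos_elem (0::'a::cstar_algebra)"
  by (rule pos_elemI[of _ 0]) simp_all

lemma pos_elem_scaleR:
  assumes "pos_elem (p::'a::cstar_algebra)" "r \<ge> 0"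
  shows "pos_elem (r *\<^sub>R p)"
proof (rule pos_elemI)
  show "cstar (r *\<^sub>R p) = r *\<^sub>R p" using assms by (simp add: cstar_scaleR pos_elem_self_adjoint)
  have "norm (r *\<^sub>R (norm p *\<^sub>R 1 - p)) \<le> r * norm p"
    using pos_elemD[OF assms(1) order_refl] assms(2) by (simp add: mult_left_mono)
  then show "norm ((r * norm p) *\<^sub>R 1 - r *\<^sub>R p) \<le> r * norm p" by (simp add: scaleR_diff_right)
qed

lemma pos_elem_sum: "(\<And>i. i \<in> F \<Longrightarrow> pos_elem (f i :: 'a::cstar_algebra)) \<Longrightarrow> pos_elem (sum f F)"
  by (induction F rule: infinite_finite_induct) (auto intro: pos_elem_add)

lemma pos_elem_LIMSEQ:
  assumes lim: "f \<longlonglongrightarrow> (p::'a::cstar_algebra)" and pos: "\<And>n. pos_elem (f n)"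
  shows "pos_elem p"
proof (rule pos_elemI)
  have "(\<lambda>n. cstar (f n)) \<longlonglongrightarrow> cstar p" by (rule bounded_linear.tendsto[OF bounded_linear_cstar lim])
  moreover have "(\<lambda>n. cstar (f n)) = f" using pos by (simp add: pos_elem_self_adjoint)
  ultimately show "cstar p = p" using lim LIMSEQ_unique by metis
  have "(\<lambda>n. norm (norm (f n) *\<^sub>R 1 - f n)) \<longlonglongrightarrow> norm (norm p *\<^sub>R 1 - p)"
    by (intro tendsto_intros lim)
  moreover have "(\<lambda>n. norm (f n)) \<longlonglongrightarrow> norm p" by (intro tendsto_intros lim)
  ultimately show "norm (norm p *\<^sub>R 1 - p) \<le> norm p"
    by (rule LIMSEQ_le) (use pos_elemD[OF pos] in auto)
qed

lemma pos_elem_square: "cstar (h::'a::cstar_algebra) = h \<Longrightarrow> pos_elem (h * h)"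
  by (rule pos_elemI[of _ "(norm h)\<^sup>2"]) (simp_all add: cstar_mult norm_scalar_minus_square)

lemma pos_elem_norm_minus:
  assumes sa: "cstar (h::'a::cstar_algebra) = h" and "norm h \<le> t"
  shows "pos_elem (t *\<^sub>R 1 - h)"
  by (rule pos_elemI[of _ t]) (use assms in \<open>simp_all add: cstar_diff cstar_scaleR\<close>)

lemma norm_le_scalar:
  fixes p :: "'a::cstar_algebra"
  assumes p: "pos_elem p" and "pos_elem (t *\<^sub>R 1 - p)" and t0: "t \<ge> 0"
  shows "norm p \<le> t"
proof (cases "p = 0")
  case False
  \<comment> \<open>Positivity excludes \<open>- norm p\<close>, so \<open>norm p\<close> itself is
    a spectral value.\<close>
  have "of_real (norm p) \<in> spectrum_elem p"
    using norm_in_spectrum[OF pos_elem_self_adjoint[OF p] False] p False unfolding pos_elem_def by force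
  then have "of_real (t - norm p) \<in> spectrum_elem (t *\<^sub>R 1 - p)"
    using spectrum_scalar_minus[of "of_real (norm p)" p t] by simp
  then show ?thesis using assms(2) unfolding pos_elem_def by force
qed (use t0 in simp)

lemma norm_mono_cle:
  fixes p q :: "'a::cstar_algebra"
  assumes p: "pos_elem p" and q: "cle p q"
  shows "norm p \<le> norm q"
proof (rule norm_le_scalar[OF p])
  have "cstar (q - p) = q - p" using q unfolding cle_def by (rule pos_elem_self_adjoint)
  then have "cstar q = q" using pos_elem_self_adjoint[OF p] by (simp add: cstar_diff)
  then have "pos_elem ((norm q *\<^sub>R 1 - q) + (q - p))"
    using q unfolding cle_def by (intro pos_elem_add pos_elem_norm_minus) auto
  then show "pos_elem (norm q *\<^sub>R 1 - p)" by simp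
qed simp

lemma cle_trans: "cle a b \<Longrightarrow> cle b (c::'a::cstar_algebra) \<Longrightarrow> cle a c"
  unfolding cle_def using pos_elem_add[of "b - a" "c - b"] by simp

lemma LIMSEQ_add_inverse_scalar:
  "(\<lambda>n. (p::'a::cstar_algebra) + inverse (real (Suc n)) *\<^sub>R 1) \<longlonglongrightarrow> p"
  using tendsto_add[OF tendsto_const[of p] tendsto_scaleR[OF LIMSEQ_inverse_real_of_nat tendsto_const[of "1::'a"]]]
  by simp

text \<open>\<open>p + e\<close> is the scalar \<open>norm p + e\<close> minus
  \<open>norm p - p\<close>, whose norm is at most \<open>norm p\<close>; \<open>e\<close> supplies
  the strict inequality that the root needs.\<close>

lemma pos_elem_sqrt_approx:
  fixes p :: "'a::cstar_algebra"
  assumes p: "pos_elem p" and e: "e > 0"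
  shows "\<exists>r. cstar r = r \<and> r * r = p + e *\<^sub>R 1 \<and> (\<forall>x. x * p = p * x \<longrightarrow> x * r = r * x)"
proof -
  let ?b = "norm p *\<^sub>R 1 - p"
  have "cstar ?b = ?b" using pos_elem_self_adjoint[OF p] by (simp add: cstar_diff cstar_scaleR)
  moreover have "norm ?b < norm p + e" using pos_elemD[OF p order_refl] e by simp
  ultimately obtain r where r: "cstar r = r" "r * r = (norm p + e) *\<^sub>R 1 - ?b"
      "\<And>x. x * ?b = ?b * x \<Longrightarrow> x * r = r * x"
    using sqrt_scalar_minus by metis
  have "x * r = r * x" if "x * p = p * x" for x
    by (rule r(3)) (simp only: that right_diff_distrib left_diff_distrib, simp)
  moreover have "r * r = p + e *\<^sub>R 1" unfolding r(2) by (simp add: scaleR_add_left)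
  ultimately show ?thesis using r(1) by blast
qed

text \<open>With a small scalar added to \<open>p\<close>, the conjugate is the square of the
  self-adjoint \<open>x * r\<close>. This case rests on squares alone and thus precedes the
  positivity of \<open>cstar a * a\<close>.\<close>

lemma pos_elem_commuting_conj:
  fixes x p :: "'a::cstar_algebra"
  assumes p: "pos_elem p" and sa: "cstar x = x" and comm: "x * p = p * x"
  shows "pos_elem (x * p * x)"
proof (rule pos_elem_LIMSEQ)
  show "(\<lambda>n. x * (p + inverse (real (Suc n)) *\<^sub>R 1) * x) \<longlonglongrightarrow> x * p * x"
    by (intro tendsto_mult tendsto_const LIMSEQ_add_inverse_scalar)
  fix n
  have "inverse (real (Suc n)) > 0" by simp
  then obtain r where r: "cstar r = r" "r * r = p + inverse (real (Suc n)) *\<^sub>R 1" "x * r = r * x"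
    using pos_elem_sqrt_approx[OF p] comm by blast
  have "x * (p + inverse (real (Suc n)) *\<^sub>R 1) * x = x * r * (r * x)"
    unfolding r(2)[symmetric] by (simp only: mult.assoc)
  also have "\<dots> = x * r * (x * r)" by (simp only: r(3))
  finally have "x * (p + inverse (real (Suc n)) *\<^sub>R 1) * x = (x * r) * (x * r)" .
  moreover have "cstar (x * r) = x * r" by (simp only: cstar_mult sa r)
  ultimately show "pos_elem (x * (p + inverse (real (Suc n)) *\<^sub>R 1) * x)"
    using pos_elem_square[of "x * r"] by (simp only:)
qed

section \<open>Positivity of \<open>a\<^sup>*a\<close> and the Cauchy--Schwarz inequality\<close>

text \<open>The formal series \<open>1 + b (1 + ab + ...) a\<close> suggests the inverse
  \<open>1 + b * c * a\<close>, where \<open>c\<close> inverts \<open>1 - a * b\<close>.\<close>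

lemma invertible_one_minus_swap:
  fixes a b :: "'a::cstar_algebra"
  assumes "invertible_elem (1 - a * b)"
  shows "invertible_elem (1 - b * a)"
proof -
  obtain c where c: "(1 - a * b) * c = 1" "c * (1 - a * b) = 1"
    using assms unfolding invertible_elem_def by blast
  have "(1 - b * a) * (1 + b * c * a) = 1 - b * a + b * ((1 - a * b) * c) * a"
    by (simp add: algebra_simps)
  moreover have "(1 + b * c * a) * (1 - b * a) = 1 - b * a + b * (c * (1 - a * b)) * a"
    by (simp add: algebra_simps)
  ultimately show ?thesis unfolding invertible_elem_def c by (intro exI[of _ "1 + b * c * a"]) simp
qed

lemma spectrum_mult_swap:
  fixes a b :: "'a::cstar_algebra"
  assumes c: "c \<in> spectrum_elem (b * a)" "c \<noteq> 0"
  shows "c \<in> spectrum_elem (a * b)"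
proof -
  have e: "x - scaleC c 1 = scaleC (- c) (1 - scaleC (1/c) x)" for x :: 'a
    using c(2) by (simp add: scaleC_diff_right scaleC_scaleC scaleC_one scaleC_minus_left)
  have inv: "invertible_elem (x - scaleC c 1) \<longleftrightarrow> invertible_elem (1 - scaleC (1/c) x)" for x :: 'a
  proof
    assume "invertible_elem (x - scaleC c 1)"
    then have "invertible_elem (scaleC (- (1/c)) (x - scaleC c 1))"
      using c(2) by (intro invertible_elem_scaleC) auto
    then show "invertible_elem (1 - scaleC (1/c) x)"
      using c(2) by (simp add: scaleC_diff_right scaleC_scaleC scaleC_one scaleC_minus_left)
  next
    assume "invertible_elem (1 - scaleC (1/c) x)"
    then show "invertible_elem (x - scaleC c 1)" unfolding e using c(2) by (intro invertible_elem_scaleC) auto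
  qed
  have "invertible_elem (1 - scaleC (1/c) (b * a))" if "invertible_elem (1 - scaleC (1/c) (a * b))"
    using invertible_one_minus_swap[of "scaleC (1/c) a" b] that
    by (simp add: scaleC_mult_left scaleC_mult_right)
  then show ?thesis using c(1) unfolding spectrum_elem_def mem_Collect_eq inv by blast
qed

text \<open>\<open>cstar a * a\<close> and \<open>a * cstar a\<close> share their nonzero spectral
  values; the value zero is harmless because \<open>t \<ge> 0\<close>.\<close>

lemma pos_elem_scalar_minus_swap:
  fixes a :: "'a::cstar_algebra"
  assumes p: "pos_elem (t *\<^sub>R 1 - cstar a * a)" and t: "t \<ge> 0"
  shows "pos_elem (t *\<^sub>R 1 - a * cstar a)"
  unfolding pos_elem_def
proof (intro conjI ballI)
  show sa: "cstar (t *\<^sub>R 1 - a * cstar a) = t *\<^sub>R 1 - a * cstar a"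
    by (simp add: cstar_diff cstar_scaleR cstar_mult cstar_cstar)
  fix c assume c: "c \<in> spectrum_elem (t *\<^sub>R 1 - a * cstar a)"
  show im: "Im c = 0" by (rule spectrum_self_adjoint_real[OF sa c])
  have c': "of_real t - c \<in> spectrum_elem (a * cstar a)"
    using c spectrum_scalar_minus[of "of_real t - c" "a * cstar a" t] by simp
  show "Re c \<ge> 0"
  proof (cases "of_real t - c = 0")
    case True
    then show ?thesis using t by (metis Re_complex_of_real eq_iff_diff_eq_0)
  next
    case False
    then have "of_real t - c \<in> spectrum_elem (cstar a * a)" using spectrum_mult_swap[OF c'] by blast
    then have "c \<in> spectrum_elem (t *\<^sub>R 1 - cstar a * a)"
      using spectrum_scalar_minus[of "of_real t - c" "cstar a * a" t] by simp
    then show ?thesis using p unfolding pos_elem_def by blast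
  qed
qed

text \<open>Up to real factors \<open>p\<close> and \<open>q\<close> are the real and imaginary
  parts of \<open>a\<close>; the terms \<open>a * a\<close> and \<open>cstar a * cstar a\<close>
  cancel in \<open>p * p + q * q\<close>.\<close>

lemma pos_elem_star_square_sum: "pos_elem (cstar a * a + a * cstar (a::'a::cstar_algebra))"
proof -
  define p where "p = a + cstar a"
  define q where "q = scaleC \<i> (a - cstar a)"
  have "cstar p = p" "cstar q = q"
    unfolding p_def q_def by (simp_all add: cstar_add cstar_diff cstar_cstar cstar_scaleC
        scaleC_minus_left scaleC_diff_right)
  then have "pos_elem ((1/2) *\<^sub>R (p * p + q * q))"
    by (intro pos_elem_scaleR pos_elem_add pos_elem_square) auto
  moreover have "q * q = - ((a - cstar a) * (a - cstar a))"
    unfolding q_def by (simp add: scaleC_mult_left scaleC_mult_right scaleC_scaleC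
        scaleC_minus_left scaleC_one)
  then have "p * p + q * q = 2 *\<^sub>R (cstar a * a + a * cstar a)"
    unfolding p_def by (simp add: algebra_simps scaleR_2)
  ultimately show ?thesis by simp
qed

text \<open>Passing from \<open>a\<close> to \<open>a(1 - a\<^sup>*a)\<close> turns the spectral value \<open>-l\<close> of \<open>a\<^sup>*a\<close> into
  \<open>-l(1 + l)\<^sup>2\<close> while keeping the upper bound \<open>1\<close>; on the other hand \<open>a\<^sup>*a \<le> 1\<close> forces
  \<open>a\<^sup>*a \<ge> -1\<close>, because \<open>a\<^sup>*a + a a\<^sup>* \<ge> 0\<close>.\<close>

lemma star_square_negative_spectrum_bound:
  fixes a :: "'a::cstar_algebra"
  assumes "pos_elem (1 - cstar a * a)" "of_real (- l) \<in> spectrum_elem (cstar a * a)" "l0 \<le> l" "0 < l0"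
  shows "l * (1 + l0) ^ n \<le> 1"
  using assms(1-3)
proof (induction n arbitrary: a l)
  case 0
  let ?k = "cstar a * a"
  have "pos_elem (1 - a * cstar a)" using pos_elem_scalar_minus_swap[of 1 a] 0(1) by simp
  from pos_elem_add[OF this pos_elem_star_square_sum[of a]] have p: "pos_elem (1 - (- ?k))" by simp
  have "of_real l \<in> spectrum_elem (- ?k)"
    using 0(2) spectrum_scalar_minus[of "of_real (- l)" ?k 0] by simp
  then have "of_real (1 - l) \<in> spectrum_elem (1 - (- ?k))"
    using spectrum_scalar_minus[of "of_real l" "- ?k" 1] by simp
  then show ?case using p unfolding pos_elem_def by force
next
  case (Suc n)
  define k where "k = cstar a * a"
  define b where "b = a * (1 - k)"
  define l' where "l' = l * (1 + l)\<^sup>2"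
  have k: "cstar k = k" unfolding k_def by (simp add: cstar_mult cstar_cstar)
  have b: "cstar b * b = (1 - k) * k * (1 - k)"
    unfolding b_def by (simp add: cstar_mult cstar_diff k mult.assoc) (simp add: k_def mult.assoc)
  \<comment> \<open>These positive summands add up to \<open>1 - cstar b * b\<close>, so the upper
    bound passes from \<open>a\<close> to \<open>b\<close>.\<close>
  have "pos_elem ((1 - k) + (k * (1 - k) * k + k * k))"
    using Suc.prems(1) k unfolding k_def[symmetric]
    by (intro pos_elem_add pos_elem_commuting_conj pos_elem_square) (simp_all add: algebra_simps)
  then have 1: "pos_elem (1 - cstar b * b)" unfolding b by (simp add: algebra_simps)
  \<comment> \<open>The quotient of \<open>k (1 - k)^2 + l (1 + l)^2\<close> by
    \<open>k + l\<close>; a noninvertible commuting factor makes the product noninvertible.\<close>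
  define q where "q = k * k - l *\<^sub>R k + (l * l + 2 * l + 1) *\<^sub>R 1 - 2 *\<^sub>R k"
  have f: "cstar b * b + l' *\<^sub>R 1 = (k + l *\<^sub>R 1) * q"
    unfolding b q_def l'_def by (simp add: algebra_simps power2_eq_square scaleR_2) (simp flip: scaleR_add_left)
  have f': "(k + l *\<^sub>R 1) * q = q * (k + l *\<^sub>R 1)"
    unfolding q_def by (simp add: algebra_simps)
  have shift: "of_real (- r) \<in> spectrum_elem x \<longleftrightarrow> \<not> invertible_elem (x + r *\<^sub>R 1)" for r and x :: 'a
    unfolding spectrum_elem_def mem_Collect_eq scaleC_of_real by simp
  have 2: "of_real (- l') \<in> spectrum_elem (cstar b * b)"
  proof -
    have "\<not> invertible_elem (k + l *\<^sub>R 1)" using Suc.prems(2) shift unfolding k_def by blast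
    then have "\<not> invertible_elem (cstar b * b + l' *\<^sub>R 1)"
      unfolding f using invertible_elem_commuting_factor[OF _ f'] by blast
    then show ?thesis using shift by blast
  qed
  have l: "l \<ge> l0" "l0 > 0" using Suc.prems(3) assms(4) by auto
  \<comment> \<open>Of the gain \<open>(1 + l)^2\<close> only the fixed factor \<open>1 + l0\<close>
    is kept, so the estimates multiply uniformly while \<open>l\<close> grows.\<close>
  have 3: "l * (1 + l0) \<le> l'"
  proof -
    have "(1 + l) * 1 \<le> (1 + l) * (1 + l)" using l by (intro mult_left_mono) auto
    moreover have "1 + l0 \<le> (1 + l) * 1" using l by simp
    ultimately have "1 + l0 \<le> (1 + l)\<^sup>2" unfolding power2_eq_square by (rule order_trans[rotated])
    then show ?thesis unfolding l'_def using l by (intro mult_left_mono) auto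
  qed
  have "l * 1 \<le> l * (1 + l0)" using l by (intro mult_left_mono) auto
  then have "l0 \<le> l'" using 3 l by linarith
  from Suc.IH[OF 1 2 this] have "l' * (1 + l0) ^ n \<le> 1" .
  moreover have "l * (1 + l0) * (1 + l0) ^ n \<le> l' * (1 + l0) ^ n"
    using 3 l by (intro mult_right_mono) auto
  ultimately show ?case by simp
qed

text \<open>After scaling to norm at most one, a spectral value \<open>-l < 0\<close> would give
  \<open>l * (1 + l) ^ n \<le> 1\<close> for all \<open>n\<close>, although these powers are
  unbounded.\<close>

lemma pos_elem_star_square: "pos_elem (cstar a * (a::'a::cstar_algebra))"
proof -
  have bounded: "pos_elem (cstar b * b)" if b: "norm b \<le> 1" for b :: 'a
    unfolding pos_elem_def
  proof (intro conjI ballI)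
    show sa: "cstar (cstar b * b) = cstar b * b" by (simp add: cstar_mult cstar_cstar)
    fix c assume c: "c \<in> spectrum_elem (cstar b * b)"
    show im: "Im c = 0" by (rule spectrum_self_adjoint_real[OF sa c])
    have "norm (cstar b * b) \<le> 1" using b by (simp add: cstar_identity power_le_one)
    from pos_elem_norm_minus[OF sa this] have p: "pos_elem (1 - cstar b * b)" by simp
    show "Re c \<ge> 0"
    proof (rule ccontr)
      define l where "l = - Re c"
      assume "\<not> Re c \<ge> 0"
      then have l: "l > 0" unfolding l_def by simp
      have "c = of_real (- l)" unfolding l_def using im by (simp add: complex_eq_iff)
      then have *: "l * (1 + l) ^ n \<le> 1" for n
        using star_square_negative_spectrum_bound[OF p _ order_refl l] c by blast
      obtain n where "1 / l < (1 + l) ^ n" using real_arch_pow[of "1 + l" "1 / l"] l by auto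
      then have "1 < l * (1 + l) ^ n" using l by (simp add: field_simps)
      then show False using *[of n] by simp
    qed
  qed
  show ?thesis
  proof (cases "a = 0")
    case False
    let ?b = "(1 / norm a) *\<^sub>R a"
    have "pos_elem ((norm a)\<^sup>2 *\<^sub>R (cstar ?b * ?b))"
      using bounded[of ?b] False by (intro pos_elem_scaleR) auto
    moreover have "(norm a)\<^sup>2 *\<^sub>R (cstar ?b * ?b) = cstar a * a"
      using False by (simp add: cstar_scaleR power2_eq_square)
    ultimately show ?thesis by simp
  qed simp
qed

lemma pos_elem_mult_star: "pos_elem (a * cstar (a::'a::cstar_algebra))"
  using pos_elem_star_square[of "cstar a"] by (simp add: cstar_cstar)

lemma pos_elem_conj:
  fixes b p :: "'a::cstar_algebra"
  assumes p: "pos_elem p"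
  shows "pos_elem (b * p * cstar b)"
proof (rule pos_elem_LIMSEQ)
  show "(\<lambda>n. b * (p + inverse (real (Suc n)) *\<^sub>R 1) * cstar b) \<longlonglongrightarrow> b * p * cstar b"
    by (intro tendsto_mult tendsto_const LIMSEQ_add_inverse_scalar)
  fix n
  have "inverse (real (Suc n)) > 0" by simp
  then obtain r where r: "cstar r = r" "r * r = p + inverse (real (Suc n)) *\<^sub>R 1"
    using pos_elem_sqrt_approx[OF p] by blast
  have "b * (p + inverse (real (Suc n)) *\<^sub>R 1) * cstar b = (b * r) * cstar (b * r)"
    unfolding r(2)[symmetric] by (simp add: cstar_mult r(1) mult.assoc)
  then show "pos_elem (b * (p + inverse (real (Suc n)) *\<^sub>R 1) * cstar b)"
    using pos_elem_mult_star[of "b * r"] by (simp only:)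
qed

text \<open>Abstract Cauchy--Schwarz inequality: \<open>P\<close>, \<open>Q\<close>, \<open>b\<close> play the roles of \<open>\<langle>x,x\<rangle>\<close>, \<open>\<langle>y,y\<rangle>\<close>,
  \<open>\<langle>x,y\<rangle>\<close>, and the hypothesis is the positivity of \<open>\<langle>x - a y, x - a y\<rangle>\<close>.\<close>

lemma cauchy_schwarz_cstar:
  fixes P Q b :: "'a::cstar_algebra"
  assumes Q: "pos_elem Q"
    and pos: "\<And>a. pos_elem (P - a * cstar b - b * cstar a + a * Q * cstar a)"
  shows "(norm b)\<^sup>2 \<le> norm P * norm Q"
proof -
  have le: "(norm b)\<^sup>2 \<le> norm P * N" if N: "N > norm Q" for N
  proof -
    have N0: "N > 0" using N norm_ge_zero[of Q] by linarith
    \<comment> \<open>Optimal choice after replacing \<open>Q\<close> by the larger scalar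
      \<open>N\<close>; it leaves \<open>P - (b * cstar b) / N\<close>. Taking
      \<open>N > norm Q\<close> avoids division by zero.\<close>
    define a where "a = (1 / N) *\<^sub>R b"
    have "pos_elem (N *\<^sub>R 1 - Q)" using N by (intro pos_elem_norm_minus pos_elem_self_adjoint[OF Q]) simp
    from pos_elem_conj[OF this, of a]
    have "pos_elem (N *\<^sub>R (a * cstar a) - a * Q * cstar a)" by (simp add: algebra_simps)
    from pos_elem_add[OF pos[of a] this]
    have "pos_elem (P - a * cstar b - b * cstar a + N *\<^sub>R (a * cstar a))" by (simp add: algebra_simps)
    moreover have "P - a * cstar b - b * cstar a + N *\<^sub>R (a * cstar a) = P - (1 / N) *\<^sub>R (b * cstar b)"
      unfolding a_def using N0 by (simp add: cstar_scaleR)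
    ultimately have "cle ((1 / N) *\<^sub>R (b * cstar b)) P" unfolding cle_def by simp
    moreover have "pos_elem ((1 / N) *\<^sub>R (b * cstar b))"
      using N0 by (intro pos_elem_scaleR pos_elem_mult_star) simp
    ultimately have "norm ((1 / N) *\<^sub>R (b * cstar b)) \<le> norm P" by (rule norm_mono_cle[rotated])
    then show ?thesis using N0 by (simp add: norm_mult_cstar field_simps)
  qed
  show ?thesis
  \<comment> \<open>The slack \<open>e / norm P\<close> used to let \<open>N\<close> approach
    \<open>norm Q\<close> needs a nonzero \<open>norm P\<close>.\<close>
  proof (cases "norm P = 0")
    case True
    then show ?thesis using le[of "norm Q + 1"] by simp
  next
    case False
    show ?thesis
    proof (rule field_le_epsilon)
      fix e :: real assume "e > 0"
      then show "(norm b)\<^sup>2 \<le> norm P * norm Q + e"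
        using le[of "norm Q + e / norm P"] False by (simp add: distrib_left)
    qed
  qed
qed

text \<open>Cauchy-Schwarz in the free module over \<open>F\<close>; it bounds the synthesis
  operator on finite index sets.\<close>

lemma cauchy_schwarz_sum:
  fixes a b :: "'i \<Rightarrow> 'a::cstar_algebra"
  shows "(norm (\<Sum>j\<in>F. a j * cstar (b j)))\<^sup>2 \<le>
    norm (\<Sum>j\<in>F. a j * cstar (a j)) * norm (\<Sum>j\<in>F. b j * cstar (b j))"
proof (rule cauchy_schwarz_cstar)
  show "pos_elem (\<Sum>j\<in>F. b j * cstar (b j))" by (intro pos_elem_sum pos_elem_mult_star)
  fix c
  have "pos_elem (\<Sum>j\<in>F. (a j - c * b j) * cstar (a j - c * b j))"
    by (intro pos_elem_sum pos_elem_mult_star)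
  also have "(\<Sum>j\<in>F. (a j - c * b j) * cstar (a j - c * b j)) =
      (\<Sum>j\<in>F. a j * cstar (a j) - c * (b j * cstar (a j)) - a j * cstar (b j) * cstar c
        + c * (b j * cstar (b j)) * cstar c)"
    by (intro sum.cong) (simp_all add: cstar_diff cstar_mult algebra_simps)
  finally show "pos_elem ((\<Sum>j\<in>F. a j * cstar (a j)) - c * cstar (\<Sum>j\<in>F. a j * cstar (b j)) -
      (\<Sum>j\<in>F. a j * cstar (b j)) * cstar c + c * (\<Sum>j\<in>F. b j * cstar (b j)) * cstar c)"
    by (simp add: sum.distrib sum_subtractf sum_distrib_left sum_distrib_right
        cstar_sum cstar_mult cstar_cstar)
qed

section \<open>Operators on Hilbert modules\<close>

locale hilbert_mod =
  fixes act :: "'a::cstar_algebra \<Rightarrow> 'h::ab_group_add \<Rightarrow> 'h"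
    and ip :: "'h \<Rightarrow> 'h \<Rightarrow> 'a"
  assumes hilbert: "hilbert_module act ip"
begin

section \<open>Sesquilinear calculus of the inner product\<close>

lemma hilbert_module_facts:
  shows act_add_left: "act (a + b) x = act a x + act b x"
    and act_one: "act 1 x = x"
    and ip_linear: "ip (act a x + y) z = a * ip x z + ip y z"
    and ip_cstar: "cstar (ip x y) = ip y x"
    and pos_ip: "pos_elem (ip x x)"
    and ip_definite: "ip x x = 0 \<Longrightarrow> x = 0"
    and complete: "(\<forall>e>0. \<exists>N. \<forall>m\<ge>N. \<forall>n\<ge>N. hnorm ip (X m - X n) < e) \<Longrightarrow>
      \<exists>L. (\<lambda>n. hnorm ip (X n - L)) \<longlonglongrightarrow> 0"
proof -
  note h = hilbert[unfolded hilbert_module_def]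
  show "act (a + b) x = act a x + act b x" by (rule h[THEN conjunct2, THEN conjunct1, rule_format])
  show "act 1 x = x" by (rule h[THEN conjunct2, THEN conjunct2, THEN conjunct2, THEN conjunct1, rule_format])
  show "ip (act a x + y) z = a * ip x z + ip y z" by (rule h[THEN conjunct2, THEN conjunct2, THEN conjunct2, THEN conjunct2, THEN conjunct1, rule_format])
  show "cstar (ip x y) = ip y x" by (rule h[THEN conjunct2, THEN conjunct2, THEN conjunct2, THEN conjunct2, THEN conjunct2, THEN conjunct1, rule_format, symmetric])
  show "pos_elem (ip x x)" by (rule h[THEN conjunct2, THEN conjunct2, THEN conjunct2, THEN conjunct2, THEN conjunct2, THEN conjunct2, THEN conjunct1, rule_format])
  show "ip x x = 0 \<Longrightarrow> x = 0" by (rule h[THEN conjunct2, THEN conjunct2, THEN conjunct2, THEN conjunct2, THEN conjunct2, THEN conjunct2, THEN conjunct2, THEN conjunct1, rule_format])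
  show "(\<forall>e>0. \<exists>N. \<forall>m\<ge>N. \<forall>n\<ge>N. hnorm ip (X m - X n) < e) \<Longrightarrow>
      \<exists>L. (\<lambda>n. hnorm ip (X n - L)) \<longlonglongrightarrow> 0"
    by (rule h[THEN conjunct2, THEN conjunct2, THEN conjunct2, THEN conjunct2, THEN conjunct2, THEN conjunct2, THEN conjunct2, THEN conjunct2, THEN spec, THEN mp])
qed

lemma ip_add_left: "ip (x + y) z = ip x z + ip y z"
  using ip_linear[of 1 x y z] by (simp add: act_one)

lemma ip_zero_left [simp]: "ip 0 z = 0"
  using ip_add_left[of 0 0 z] by simp

lemma ip_act_left: "ip (act a x) z = a * ip x z"
  using ip_linear[of a x 0 z] by simp

lemma ip_diff_left: "ip (x - y) z = ip x z - ip y z"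
  using ip_add_left[of "x - y" y z] by simp

lemma ip_sum_left: "ip (sum f F) z = (\<Sum>i\<in>F. ip (f i) z)"
  by (induction F rule: infinite_finite_induct) (simp_all add: ip_add_left)

lemma ip_zero_right [simp]: "ip z 0 = 0"
  using ip_cstar[of 0 z] by simp

lemma ip_add_right: "ip z (x + y) = ip z x + ip z y"
  using ip_cstar[of "x + y" z] by (simp add: ip_add_left cstar_add ip_cstar)

lemma ip_diff_right: "ip z (x - y) = ip z x - ip z y"
  using ip_cstar[of "x - y" z] by (simp add: ip_diff_left cstar_diff ip_cstar)

lemma ip_act_right: "ip z (act a x) = ip z x * cstar a"
  using ip_cstar[of "act a x" z] by (simp add: ip_act_left cstar_mult ip_cstar)

lemma ip_sum_right: "ip z (sum f F) = (\<Sum>i\<in>F. ip z (f i))"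
  by (induction F rule: infinite_finite_induct) (simp_all add: ip_add_right)

lemma ip_ext: "(\<And>z. ip x z = ip y z) \<Longrightarrow> x = y"
  using ip_definite[of "x - y"] by (simp add: ip_diff_left)

text \<open>The module type has no scalar multiplication of its own, so real scalars act through
  multiples of the unit.\<close>

definition sc :: "real \<Rightarrow> 'h \<Rightarrow> 'h" where
  "sc r x = act (r *\<^sub>R 1) x"

lemma ip_sc_left: "ip (sc r x) y = r *\<^sub>R ip x y"
  by (simp add: sc_def ip_act_left)

lemma ip_sc_right: "ip x (sc r y) = r *\<^sub>R ip x y"
  by (simp add: sc_def ip_act_right cstar_scaleR)

lemma sc_diff: "sc r x - sc r y = sc r (x - y)"
  by (rule ip_ext) (simp add: ip_sc_left ip_diff_left scaleR_diff_right)

section \<open>The module norm and convergence\<close>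

abbreviation nrm :: "'h \<Rightarrow> real" where
  "nrm \<equiv> hnorm ip"

lemma nrm_ge_0 [simp]: "nrm x \<ge> 0"
  by (simp add: hnorm_def)

lemma nrm_square: "(nrm x)\<^sup>2 = norm (ip x x)"
  by (simp add: hnorm_def)

lemma nrm_zero [simp]: "nrm 0 = 0"
  by (simp add: hnorm_def)

lemma nrm_eq_0: "nrm x = 0 \<Longrightarrow> x = 0"
  using nrm_square[of x] ip_definite[of x] by simp

lemma cauchy_schwarz: "norm (ip x y) \<le> nrm x * nrm y"
proof -
  have "(norm (ip x y))\<^sup>2 \<le> norm (ip x x) * norm (ip y y)"
  proof (rule cauchy_schwarz_cstar[OF pos_ip])
    fix a
    show "pos_elem (ip x x - a * cstar (ip x y) - ip x y * cstar a + a * ip y y * cstar a)"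
      using pos_ip[of "x - act a y"]
      by (simp add: ip_diff_left ip_diff_right ip_act_left ip_act_right ip_cstar algebra_simps)
  qed
  then have "(norm (ip x y))\<^sup>2 \<le> (nrm x * nrm y)\<^sup>2" by (simp add: power_mult_distrib nrm_square)
  then show ?thesis by (rule power2_le_imp_le) simp
qed

lemma nrm_triangle: "nrm (x + y) \<le> nrm x + nrm y"
proof -
  have "(nrm (x + y))\<^sup>2 = norm ((ip x x + ip x y) + (ip y x + ip y y))"
    by (simp add: nrm_square ip_add_left ip_add_right algebra_simps)
  also have "\<dots> \<le> (norm (ip x x) + norm (ip x y)) + (norm (ip y x) + norm (ip y y))"
    by (intro order_trans[OF norm_triangle_ineq] add_mono norm_triangle_ineq)
  also have "\<dots> \<le> ((nrm x)\<^sup>2 + nrm x * nrm y) + (nrm y * nrm x + (nrm y)\<^sup>2)"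
    by (intro add_mono cauchy_schwarz) (simp_all add: nrm_square)
  also have "\<dots> = (nrm x + nrm y)\<^sup>2" by (simp add: power2_eq_square algebra_simps)
  finally show ?thesis by (rule power2_le_imp_le) simp
qed

lemma nrm_diff_triangle: "nrm (x - z) \<le> nrm (x - y) + nrm (y - z)"
  using nrm_triangle[of "x - y" "y - z"] by simp

lemma nrm_diff_commute: "nrm (x - y) = nrm (y - x)"
  by (simp add: hnorm_def ip_diff_left ip_diff_right algebra_simps)

lemma nrm_sc: "nrm (sc r x) = \<bar>r\<bar> * nrm x"
proof -
  have "(nrm (sc r x))\<^sup>2 = norm (r *\<^sub>R (r *\<^sub>R ip x x))"
    by (simp only: nrm_square ip_sc_left ip_sc_right)
  also have "\<dots> = \<bar>r\<bar> * \<bar>r\<bar> * (nrm x)\<^sup>2" by (simp add: nrm_square abs_mult)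
  also have "\<dots> = (\<bar>r\<bar> * nrm x)\<^sup>2" by (simp only: power2_eq_square mult_ac)
  finally have "(nrm (sc r x))\<^sup>2 = (\<bar>r\<bar> * nrm x)\<^sup>2" .
  then show ?thesis by (simp add: power2_eq_iff_nonneg)
qed

text \<open>The module type carries only a group structure, so convergence is expressed through the
  real-valued norm.\<close>

definition hlim :: "(nat \<Rightarrow> 'h) \<Rightarrow> 'h \<Rightarrow> bool" where
  "hlim X L \<longleftrightarrow> (\<lambda>n. nrm (X n - L)) \<longlonglongrightarrow> 0"

lemma hlim_const: "hlim (\<lambda>n. x) x"
  by (simp add: hlim_def)

lemma hlim_ip:
  assumes X: "hlim X x" and Y: "hlim Y y"
  shows "(\<lambda>n. ip (X n) (Y n)) \<longlonglongrightarrow> ip x y"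
proof -
  let ?a = "\<lambda>n. nrm (X n - x)" and ?b = "\<lambda>n. nrm (Y n - y)"
  have "(\<lambda>n. ip (X n) (Y n) - ip x y) \<longlonglongrightarrow> 0"
  proof (rule Lim_null_comparison)
    show "(\<lambda>n. ?a n * ?b n + (?a n * nrm y + nrm x * ?b n)) \<longlonglongrightarrow> 0"
      using X Y unfolding hlim_def by (auto intro!: tendsto_eq_intros)
    show "\<forall>\<^sub>F n in sequentially. norm (ip (X n) (Y n) - ip x y)
        \<le> ?a n * ?b n + (?a n * nrm y + nrm x * ?b n)"
    proof (intro always_eventually allI)
      fix n
      have "ip (X n) (Y n) - ip x y =
          ip (X n - x) (Y n - y) + (ip (X n - x) y + ip x (Y n - y))"
        by (simp add: ip_diff_left ip_diff_right)
      also have "norm \<dots> \<le> norm (ip (X n - x) (Y n - y)) + (norm (ip (X n - x) y) + norm (ip x (Y n - y)))"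
        by (intro order_trans[OF norm_triangle_ineq] add_mono norm_triangle_ineq order_refl)
      also have "\<dots> \<le> ?a n * ?b n + (?a n * nrm y + nrm x * ?b n)"
        by (intro add_mono cauchy_schwarz)
      finally show "norm (ip (X n) (Y n) - ip x y) \<le> ?a n * ?b n + (?a n * nrm y + nrm x * ?b n)" .
    qed
  qed
  then show ?thesis by (simp add: LIM_zero_iff)
qed

lemma hlim_nrm_le:
  assumes X: "hlim X x" and K: "\<And>n. nrm (X n) \<le> K"
  shows "nrm x \<le> K"
proof -
  have "(\<lambda>n. K + nrm (X n - x)) \<longlonglongrightarrow> K + 0"
    using X unfolding hlim_def by (intro tendsto_intros)
  moreover have "nrm x \<le> K + nrm (X n - x)" for n
    using nrm_triangle[of "X n" "x - X n"] K[of n] nrm_diff_commute[of "X n" x] by simp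
  ultimately show ?thesis using LIMSEQ_le_const[of _ "K + 0" "nrm x"] by auto
qed

text \<open>Telescoping bounds the distances by differences of geometric partial sums, which form a
  Cauchy sequence of reals.\<close>

lemma hlim_geometric:
  assumes step: "\<And>n. nrm (X (Suc n) - X n) \<le> K * q ^ n" and q: "0 \<le> q" "q < 1"
  shows "\<exists>L. hlim X L"
  unfolding hlim_def
proof (rule complete, intro allI impI)
  fix e :: real assume e: "e > 0"
  define s where "s n = (\<Sum>k<n. K * q ^ k)" for n
  have le: "nrm (X (n + d) - X n) \<le> s (n + d) - s n" for n d
  proof (induction d)
    case (Suc d)
    have "nrm (X (n + Suc d) - X n) \<le> nrm (X (Suc (n + d)) - X (n + d)) + nrm (X (n + d) - X n)"
      using nrm_diff_triangle by simp
    also have "\<dots> \<le> K * q ^ (n + d) + (s (n + d) - s n)" by (intro add_mono step Suc)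
    finally show ?case by (simp add: s_def)
  qed simp
  have "summable (\<lambda>k. K * q ^ k)" using q by (intro summable_mult summable_geometric) simp
  then have "Cauchy s" unfolding s_def summable_iff_convergent by (rule convergent_Cauchy)
  then obtain N where N: "\<And>m n. m \<ge> N \<Longrightarrow> n \<ge> N \<Longrightarrow> norm (s m - s n) < e"
    using CauchyD[OF _ e] by blast
  have "nrm (X m - X n) < e" if "n \<ge> N" "m \<ge> n" for m n
    using le[of n "m - n"] N[of m n] that by (simp add: abs_less_iff)
  then have "nrm (X m - X n) < e" if "m \<ge> N" "n \<ge> N" for m n
    using that nrm_diff_commute[of "X m" "X n"] by (metis nle_le)
  then show "\<exists>N. \<forall>m\<ge>N. \<forall>n\<ge>N. nrm (X m - X n) < e" by blast
qed

section \<open>Square roots and inverses of self-adjoint operators\<close>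

definition selfadj :: "('h \<Rightarrow> 'h) \<Rightarrow> bool" where
  "selfadj T \<longleftrightarrow> adjoint_of ip T T"

lemma selfadjD: "selfadj T \<Longrightarrow> ip (T x) y = ip x (T y)"
  by (simp add: selfadj_def adjoint_of_def)

text \<open>Inner products separate points, so an adjoint forces linearity; operators obtained as
  limits need no separate linearity argument.\<close>

lemma adjoint_alinear:
  assumes "\<And>x y. ip (T x) y = ip x (S y)"
  shows "alinear act T"
  unfolding alinear_def
  by (intro allI ip_ext) (simp add: assms ip_linear)

lemma alinear_diff: "alinear act T \<Longrightarrow> T (x - y) = T x - T y"
  unfolding alinear_def
  by (metis act_one add_diff_cancel diff_add_cancel)

lemma alinear_zero: "alinear act T \<Longrightarrow> T 0 = 0"
  using alinear_diff[of T 0 0] by simp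

lemma alinear_sc: "alinear act T \<Longrightarrow> T (sc r x) = sc r (T x)"
  using alinear_zero[of T] unfolding alinear_def sc_def by (metis add.right_neutral)

primrec sqrt_iter :: "('h \<Rightarrow> 'h) \<Rightarrow> nat \<Rightarrow> 'h \<Rightarrow> 'h" where
  "sqrt_iter B 0 = (\<lambda>x. 0)"
| "sqrt_iter B (Suc n) = (\<lambda>x. sc (1/2) (B x + sqrt_iter B n (sqrt_iter B n x)))"

text \<open>\<open>(1 - Y)\<^sup>2 = 1 - B\<close> is the fixed point equation \<open>Y = (B + Y\<^sup>2)/2\<close>, whose right-hand side
  is a contraction with factor \<open>q\<close> on the operators of norm at most \<open>q\<close>.\<close>

lemma op_sqrt_one_minus:
  assumes sa: "selfadj B" and bound: "\<And>x. nrm (B x) \<le> q * nrm x" and q: "0 \<le> q" "q < 1"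
  obtains Y where "selfadj Y" "\<And>x. nrm (Y x) \<le> q * nrm x"
    "\<And>x. (x - Y x) - Y (x - Y x) = x - B x"
proof -
  let ?Y = "sqrt_iter B"
  have saY: "ip (?Y n x) y = ip x (?Y n y)" for n x y
    by (induction n arbitrary: x y)
      (simp_all add: ip_sc_left ip_sc_right ip_add_left ip_add_right selfadjD[OF sa])
  have bY: "nrm (?Y n x) \<le> q * nrm x" for n x
  proof (induction n arbitrary: x)
    case (Suc n)
    have "nrm (?Y n (?Y n x)) \<le> q * nrm (?Y n x)" by (rule Suc)
    also have "\<dots> \<le> 1 * (q * nrm x)" using q by (intro mult_mono Suc) auto
    finally have "nrm (B x + ?Y n (?Y n x)) \<le> q * nrm x + q * nrm x"
      using nrm_triangle[of "B x" "?Y n (?Y n x)"] bound[of x] by simp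
    then show ?case by (simp add: nrm_sc)
  qed (simp add: q)
  have diffY: "?Y n (x - y) = ?Y n x - ?Y n y" for n x y
    using alinear_diff[OF adjoint_alinear[OF saY]] .
  have step: "nrm (?Y (Suc n) x - ?Y n x) \<le> nrm x * q ^ n" for n x
  proof (induction n arbitrary: x)
    case 0
    have "nrm (?Y (Suc 0) x) \<le> 1 * nrm x" using q by (intro order_trans[OF bY] mult_right_mono) auto
    then show ?case by simp
  next
    case (Suc n)
    let ?A = "?Y (Suc n)" and ?D = "\<lambda>x. ?Y (Suc n) x - ?Y n x"
    have "?Y (Suc (Suc n)) x - ?A x =
        sc (1/2) (B x + ?A (?A x)) - sc (1/2) (B x + ?Y n (?Y n x))" by (simp only: sqrt_iter.simps)
    also have "\<dots> = sc (1/2) (?A (?A x) - ?Y n (?Y n x))"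
      by (simp only: sc_diff add_diff_cancel_left)
    \<comment> \<open>\<open>A A - Y Y = A D + D Y\<close> for \<open>D = A - Y\<close> without any
      commutation; each summand gains one factor \<open>q\<close>.\<close>
    also have "\<dots> = sc (1/2) (?A (?D x) + ?D (?Y n x))"
      by (simp only: diffY) (simp del: sqrt_iter.simps)
    finally have "?Y (Suc (Suc n)) x - ?A x = sc (1/2) (?A (?D x) + ?D (?Y n x))" .
    moreover have "nrm (?A (?D x) + ?D (?Y n x)) \<le> nrm x * q ^ Suc n + nrm x * q ^ Suc n"
    proof -
      have "nrm (?A (?D x)) \<le> q * (nrm x * q ^ n)"
        using q by (intro order_trans[OF bY] mult_left_mono Suc) auto
      moreover have "nrm (?D (?Y n x)) \<le> (q * nrm x) * q ^ n"
        using q by (intro order_trans[OF Suc] mult_right_mono bY) auto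
      ultimately show ?thesis using nrm_triangle[of "?A (?D x)" "?D (?Y n x)"] by (simp only: power_Suc mult_ac)
    qed
    ultimately show ?case by (simp only: nrm_sc)
  qed
  have "\<exists>L. hlim (\<lambda>n. ?Y n x) L" for x
    by (rule hlim_geometric[OF step q])
  then obtain Y where Y: "\<And>x. hlim (\<lambda>n. ?Y n x) (Y x)" by metis
  have lim: "(\<lambda>n. ip (?Y n x) z) \<longlonglongrightarrow> ip (Y x) z" for x z
    by (rule hlim_ip[OF Y hlim_const])
  have limr: "(\<lambda>n. ip z (?Y n x)) \<longlonglongrightarrow> ip z (Y x)" for x z
    by (rule hlim_ip[OF hlim_const Y])
  have saY': "ip (Y x) y = ip x (Y y)" for x y
    by (rule LIMSEQ_unique[OF lim]) (simp only: saY limr)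
  \<comment> \<open>Self-adjointness moves one factor of the squared iterate to the right, so
    pointwise convergence suffices for the limit.\<close>
  have eq: "ip (Y x) z = (1/2) *\<^sub>R (ip (B x) z + ip (Y x) (Y z))" for x z
  proof (rule LIMSEQ_unique)
    show "(\<lambda>n. ip (?Y (Suc n) x) z) \<longlonglongrightarrow> ip (Y x) z" by (rule LIMSEQ_Suc[OF lim])
    have "(\<lambda>n. (1/2) *\<^sub>R (ip (B x) z + ip (?Y n x) (?Y n z))) \<longlonglongrightarrow> (1/2) *\<^sub>R (ip (B x) z + ip (Y x) (Y z))"
      by (intro tendsto_intros hlim_ip Y)
    then show "(\<lambda>n. ip (?Y (Suc n) x) z) \<longlonglongrightarrow> (1/2) *\<^sub>R (ip (B x) z + ip (Y x) (Y z))"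
      by (simp add: ip_sc_left ip_add_left saY)
  qed
  show ?thesis
  proof
    show "selfadj Y" using saY' by (simp add: selfadj_def adjoint_of_def)
    show "nrm (Y x) \<le> q * nrm x" for x using hlim_nrm_le[OF Y bY] .
    show "(x - Y x) - Y (x - Y x) = x - B x" for x
    proof (rule ip_ext)
      fix z
      have "2 *\<^sub>R ip (Y x) z = ip (B x) z + ip (Y x) (Y z)" using eq[of x z] by simp
      then show "ip ((x - Y x) - Y (x - Y x)) z = ip (x - B x) z"
        by (simp only: ip_diff_left ip_diff_right saY' scaleR_2) (simp add: algebra_simps)
    qed
  qed
qed

text \<open>With \<open>1 - B = (1 - Y)^2\<close> and \<open>Y\<close> self-adjoint, the form at
  \<open>x\<close> is the inner product of \<open>x - Y x\<close> with itself.\<close>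

lemma op_one_minus_pos:
  assumes "selfadj B" "\<And>x. nrm (B x) \<le> q * nrm x" "0 \<le> q" "q < 1"
  shows "pos_elem (ip (x - B x) x)"
proof -
  obtain Y where Y: "selfadj Y" "\<And>x. (x - Y x) - Y (x - Y x) = x - B x"
    using op_sqrt_one_minus[OF assms] by metis
  have "ip (x - B x) x = ip (x - Y x) (x - Y x)"
    unfolding Y(2)[symmetric] using selfadjD[OF Y(1)] by (simp add: ip_diff_left ip_diff_right)
  then show ?thesis by (simp add: pos_ip)
qed

text \<open>For additive \<open>Y\<close>, these are the partial sums of the Neumann series, in
  Horner form.\<close>

primrec neumann_iter :: "('h \<Rightarrow> 'h) \<Rightarrow> 'h \<Rightarrow> nat \<Rightarrow> 'h" where
  "neumann_iter Y x 0 = 0"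
| "neumann_iter Y x (Suc n) = x + Y (neumann_iter Y x n)"

text \<open>The limit of the Neumann iteration is a right inverse of \<open>1 - Y\<close>; a strict
  contraction makes \<open>1 - Y\<close> injective, so the inverse is two-sided.\<close>

lemma op_one_minus_inverse:
  assumes sa: "selfadj Y" and bound: "\<And>x. nrm (Y x) \<le> q * nrm x" and q: "0 \<le> q" "q < 1"
  obtains Z where "selfadj Z" "\<And>x. nrm (Z x) \<le> 1 / (1 - q) * nrm x"
    "\<And>x. Z (x - Y x) = x" "\<And>x. Z x - Y (Z x) = x"
proof -
  have diffY: "Y (x - y) = Y x - Y y" for x y
    using alinear_diff[OF adjoint_alinear] selfadjD[OF sa] by blast
  have step: "nrm (neumann_iter Y x (Suc n) - neumann_iter Y x n) \<le> nrm x * q ^ n" for n x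
  proof (induction n)
    case 0
    then show ?case using alinear_zero[OF adjoint_alinear[OF selfadjD[OF sa]]] by simp
  next
    case (Suc n)
    have "neumann_iter Y x (Suc (Suc n)) - neumann_iter Y x (Suc n) =
        Y (neumann_iter Y x (Suc n) - neumann_iter Y x n)" by (simp only: diffY) simp
    also have "nrm \<dots> \<le> q * (nrm x * q ^ n)"
      using q by (intro order_trans[OF bound] mult_left_mono Suc) auto
    finally show ?case by (simp add: mult_ac)
  qed
  have "\<exists>L. hlim (neumann_iter Y x) L" for x by (rule hlim_geometric[OF step q])
  then obtain Z where Z: "\<And>x. hlim (neumann_iter Y x) (Z x)" by metis
  have fixpt: "Z x = x + Y (Z x)" for x
  proof (rule ip_ext)
    fix z
    have lim: "(\<lambda>n. ip (neumann_iter Y x n) z) \<longlonglongrightarrow> ip (Z x) z" for z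
      by (rule hlim_ip[OF Z hlim_const])
    have "(\<lambda>n. ip x z + ip (neumann_iter Y x n) (Y z)) \<longlonglongrightarrow> ip x z + ip (Z x) (Y z)"
      by (intro tendsto_intros lim)
    moreover have "(\<lambda>n. ip (neumann_iter Y x (Suc n)) z) \<longlonglongrightarrow> ip (Z x) z"
      by (rule LIMSEQ_Suc[OF lim])
    ultimately show "ip (Z x) z = ip (x + Y (Z x)) z"
      by (simp add: ip_add_left selfadjD[OF sa] LIMSEQ_unique)
  qed
  have Zr: "Z x - Y (Z x) = x" for x using fixpt[of x] by (metis add_diff_cancel_right')
  have inj: "u = v" if "u - Y u = v - Y v" for u v
  proof -
    have "u - v = Y (u - v)" using that by (simp add: diffY algebra_simps)
    then have "nrm (u - v) \<le> q * nrm (u - v)" using bound[of "u - v"] by simp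
    then have "(1 - q) * nrm (u - v) \<le> 0" by (simp add: algebra_simps)
    then have "nrm (u - v) = 0" using q nrm_ge_0[of "u - v"] by (simp add: mult_le_0_iff)
    then show ?thesis using nrm_eq_0[of "u - v"] by simp
  qed
  show ?thesis
  proof
    have "ip (Z x) y = ip x (Z y)" for x y
    proof -
      have "ip (Z x) y = ip (Z x) (Z y - Y (Z y))" by (simp only: Zr)
      also have "\<dots> = ip (Z x - Y (Z x)) (Z y)" by (simp only: ip_diff_left ip_diff_right selfadjD[OF sa])
      finally show ?thesis by (simp only: Zr)
    qed
    then show "selfadj Z" by (simp add: selfadj_def adjoint_of_def)
    show "nrm (Z x) \<le> 1 / (1 - q) * nrm x" for x
    proof -
      have "nrm (Z x) \<le> nrm x + nrm (Y (Z x))" by (metis fixpt nrm_triangle)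
      then have "nrm (Z x) \<le> nrm x + q * nrm (Z x)" using bound[of "Z x"] by simp
      then show ?thesis using q by (simp add: field_simps)
    qed
    show "Z (x - Y x) = x" for x by (rule inj) (rule Zr)
    show "Z x - Y (Z x) = x" for x by (rule Zr)
  qed
qed

section \<open>Passing between norm bounds and form bounds\<close>

lemma alinear_act: "alinear act T \<Longrightarrow> T (act a x) = act a (T x)"
  using alinear_zero[of T] unfolding alinear_def by (metis add.right_neutral)

text \<open>Cauchy-Schwarz for the semi-inner product \<open>ip (B x) y\<close> at
  \<open>y = B x\<close>, with the form bound \<open>q\<close> applied at both \<open>x\<close> and
  \<open>B x\<close>.\<close>

lemma positive_form_bound:
  assumes sa: "selfadj B" and pos: "\<And>x. pos_elem (ip (B x) x)"
    and upper: "\<And>x. cle (ip (B x) x) (q *\<^sub>R ip x x)" and q: "0 \<le> q"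
  shows "nrm (B x) \<le> q * nrm x"
proof -
  have lin: "alinear act B" by (rule adjoint_alinear[OF selfadjD[OF sa]])
  have form: "norm (ip (B z) z) \<le> q * (nrm z)\<^sup>2" for z
    using norm_mono_cle[OF pos upper, of z] q by (simp add: nrm_square)
  let ?y = "B x"
  have "((nrm ?y)\<^sup>2)\<^sup>2 = (norm (ip (B x) ?y))\<^sup>2" by (simp only: nrm_square)
  also have "\<dots> \<le> norm (ip (B x) x) * norm (ip (B ?y) ?y)"
  proof (rule cauchy_schwarz_cstar[OF pos])
    fix a
    have "cstar (ip (B x) ?y) = ip (B ?y) x" using selfadjD[OF sa, of ?y x] by (simp add: ip_cstar)
    then show "pos_elem (ip (B x) x - a * cstar (ip (B x) ?y) - ip (B x) ?y * cstar a
        + a * ip (B ?y) ?y * cstar a)"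
      using pos[of "x - act a ?y"]
      by (simp add: alinear_diff[OF lin] alinear_act[OF lin] ip_diff_left ip_diff_right
          ip_act_left ip_act_right algebra_simps)
  qed
  also have "\<dots> \<le> (q * (nrm x)\<^sup>2) * (q * (nrm ?y)\<^sup>2)"
    using q by (intro mult_mono form) auto
  also have "\<dots> = (q * nrm x * nrm ?y)\<^sup>2" by (simp only: power2_eq_square mult_ac)
  finally have "(nrm ?y)\<^sup>2 \<le> q * nrm x * nrm ?y"
    by (rule power2_le_imp_le) (simp add: q)
  then have "nrm ?y * nrm ?y \<le> q * nrm x * nrm ?y" by (simp only: power2_eq_square)
  then show ?thesis using nrm_ge_0[of ?y] q
    by (cases "nrm ?y = 0") (auto simp: mult_le_cancel_right)
qed

text \<open>Upgrades a norm bound to an inequality in the algebra: \<open>U V / M\<close> is a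
  strict contraction, so \<open>1 - U V / M\<close> has a positive form, and
  \<open>ip (U (V x)) x = ip (V x) (V x)\<close>.\<close>

lemma adjoint_form_bound:
  assumes adj: "\<And>x y. ip (U x) y = ip x (V y)" and bound: "\<And>x. nrm (U x) \<le> K * nrm x"
  shows "\<exists>M>0. \<forall>x. cle (ip (V x) (V x)) (M *\<^sub>R ip x x)"
proof -
  define k where "k = \<bar>K\<bar>"
  have bU: "nrm (U x) \<le> k * nrm x" for x
    using bound[of x] mult_right_mono[OF abs_ge_self[of K] nrm_ge_0[of x]] unfolding k_def by linarith
  have bV: "nrm (V x) \<le> k * nrm x" for x
  proof -
    have "nrm (V x) * nrm (V x) = norm (ip (U (V x)) x)"
      by (simp add: adj nrm_square flip: power2_eq_square)
    also have "\<dots> \<le> nrm (U (V x)) * nrm x" by (rule cauchy_schwarz)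
    also have "\<dots> \<le> k * nrm (V x) * nrm x" by (intro mult_right_mono bU) simp
    finally have "nrm (V x) * nrm (V x) \<le> k * nrm x * nrm (V x)" by (simp add: mult_ac)
    then show ?thesis using nrm_ge_0[of "V x"]
      by (cases "nrm (V x) = 0") (auto simp: mult_le_cancel_right k_def)
  qed
  \<comment> \<open>The summand one makes the contraction factor \<open>k * k / M\<close> strictly
    less than one.\<close>
  define M where "M = k * k + 1"
  have M: "M > 0" unfolding M_def by (simp add: add_nonneg_pos)
  define B where "B x = sc (1 / M) (U (V x))" for x
  have adj': "ip (V x) y = ip x (U y)" for x y
    using arg_cong[OF adj[of y x], of cstar] by (simp add: ip_cstar)
  have sa: "selfadj B"
    unfolding selfadj_def adjoint_of_def B_def by (simp add: ip_sc_left ip_sc_right adj adj')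
  have bB: "nrm (B x) \<le> k * k / M * nrm x" for x
  proof -
    have "nrm (U (V x)) \<le> k * (k * nrm x)"
      by (intro order_trans[OF bU] mult_left_mono bV) (simp add: k_def)
    then show ?thesis unfolding B_def using M by (simp add: nrm_sc divide_simps mult_ac)
  qed
  have "cle (ip (V x) (V x)) (M *\<^sub>R ip x x)" for x
  proof -
    have "pos_elem (ip (x - B x) x)"
      by (rule op_one_minus_pos[OF sa bB]) (use M in \<open>simp_all add: M_def\<close>)
    then have "pos_elem (M *\<^sub>R ip (x - B x) x)" using M by (intro pos_elem_scaleR) auto
    then show ?thesis
      unfolding cle_def B_def using M by (simp add: ip_diff_left ip_sc_left adj scaleR_diff_right)
  qed
  then show ?thesis using M by blast
qed

text \<open>The frame series of \<open>T (y j)\<close> at \<open>v\<close> is that of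
  \<open>y j\<close> at \<open>T' v\<close>, with sum \<open>ip (T' v) (T' v)\<close>; form bounds
  for the adjoints of \<open>T\<close> and of its inverse yield the frame bounds.\<close>

lemma standard_frame_image:
  assumes y: "standard_nt_frame act ip J y" and T: "invertible_op act ip T"
  shows "standard_frame act ip J (\<lambda>j. T (y j))"
proof -
  obtain S where "good_op act ip T" "good_op act ip S" and TS: "\<And>x. T (S x) = x"
    using T unfolding invertible_op_def by blast
  then obtain T' S' K L where T': "\<And>u v. ip (T u) v = ip u (T' v)" and S': "\<And>u v. ip (S u) v = ip u (S' v)"
    and K: "\<And>x. nrm (T x) \<le> K * nrm x" and L: "\<And>x. nrm (S x) \<le> L * nrm x"
    unfolding good_op_def bounded_op_def adjointable_def adjoint_of_def by metis
  obtain M where M: "M > 0" "\<And>v. cle (ip (T' v) (T' v)) (M *\<^sub>R ip v v)"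
    using adjoint_form_bound[OF T' K] by blast
  obtain N where N: "N > 0" "\<And>v. cle (ip (S' v) (S' v)) (N *\<^sub>R ip v v)"
    using adjoint_form_bound[OF S' L] by blast
  \<comment> \<open>Dualizing \<open>T S = 1\<close> turns the upper bound for \<open>S'\<close> at
    \<open>T' v\<close> into the lower bound for \<open>T'\<close>.\<close>
  have S'T': "S' (T' v) = v" for v
  proof -
    have "ip z (S' (T' v)) = ip z v" for z using S'[of z "T' v"] T'[of "S z" v] TS by simp
    then have "ip (S' (T' v)) z = ip v z" for z using ip_cstar by metis
    then show ?thesis by (rule ip_ext)
  qed
  have T'': "ip v (T u) = ip (T' v) u" for u v
    using arg_cong[OF T'[of u v], of cstar] by (simp add: ip_cstar)
  have "jsums J (\<lambda>j. ip v (T (y j)) * ip (T (y j)) v) (ip (T' v) (T' v))" for v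
    using y unfolding standard_nt_frame_def by (simp add: T' T'')
  moreover have "cle ((1 / N) *\<^sub>R ip v v) (ip (T' v) (T' v))" for v
  proof -
    have "pos_elem ((1 / N) *\<^sub>R (N *\<^sub>R ip (T' v) (T' v) - ip v v))"
      using N(2)[of "T' v"] N(1) unfolding S'T' cle_def by (intro pos_elem_scaleR) auto
    then show ?thesis unfolding cle_def using N(1) by (simp add: scaleR_diff_right)
  qed
  ultimately show ?thesis unfolding standard_frame_def using M N(1)
    by (intro exI[of _ "1 / N"] exI[of _ M]) auto
qed

end

section \<open>Frames\<close>

lemma cle_jsums:
  fixes f :: "nat \<Rightarrow> 'a::cstar_algebra"
  assumes s: "jsums J f s" and pos: "\<And>j. j \<in> J \<Longrightarrow> pos_elem (f j)" and F: "finite F" "F \<subseteq> J"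
  shows "cle (sum f F) s"
proof -
  obtain N where N: "F \<subseteq> {..<N}" using F(1) finite_nat_iff_bounded by auto
  show ?thesis
    unfolding cle_def
  proof (rule pos_elem_LIMSEQ)
    \<comment> \<open>Shifting by \<open>N\<close> makes every partial index set contain
      \<open>F\<close>.\<close>
    show "(\<lambda>n. (\<Sum>j\<in>J \<inter> {..<n + N}. f j) - sum f F) \<longlonglongrightarrow> s - sum f F"
      using s unfolding jsums_def by (intro tendsto_diff tendsto_const LIMSEQ_ignore_initial_segment)
    fix n
    have "F \<subseteq> J \<inter> {..<n + N}" using N F(2) by fastforce
    then have "(\<Sum>j\<in>J \<inter> {..<n + N}. f j) - sum f F = (\<Sum>j\<in>J \<inter> {..<n + N} - F. f j)"
      by (subst sum_diff) auto
    then show "pos_elem ((\<Sum>j\<in>J \<inter> {..<n + N}. f j) - sum f F)"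
      using pos by (auto intro!: pos_elem_sum)
  qed
qed

lemma sum_Int_lessThan_diff:
  fixes f :: "nat \<Rightarrow> 'a::ab_group_add"
  assumes "n \<le> m"
  shows "(\<Sum>j\<in>A \<inter> {..<m}. f j) - (\<Sum>j\<in>A \<inter> {..<n}. f j) = (\<Sum>j\<in>A \<inter> {n..<m}. f j)"
proof -
  have split: "A \<inter> {n..<m} = A \<inter> {..<m} - A \<inter> {..<n}" by auto
  have "A \<inter> {..<n} \<subseteq> A \<inter> {..<m}" using assms by auto
  then show ?thesis unfolding split by (intro sum_diff[symmetric]) auto
qed

section \<open>Synthesis and the frame operator\<close>

locale frame = hilbert_mod act ip
  for act :: "'a::cstar_algebra \<Rightarrow> 'h::ab_group_add \<Rightarrow> 'h" and ip :: "'h \<Rightarrow> 'h \<Rightarrow> 'a" +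
  fixes J :: "nat set" and x :: "nat \<Rightarrow> 'h" and C D :: real and s :: "'h \<Rightarrow> 'a"
  assumes C: "C > 0" and D: "D > 0"
    and sums: "jsums J (\<lambda>j. ip v (x j) * ip (x j) v) (s v)"
    and lower: "cle (C *\<^sub>R ip v v) (s v)" and upper: "cle (s v) (D *\<^sub>R ip v v)"
begin

lemma pos_frame_term: "pos_elem (ip v (x j) * ip (x j) v)"
  using pos_elem_mult_star[of "ip v (x j)"] by (simp add: ip_cstar)

text \<open>Pairing \<open>w\<close> with itself and applying Cauchy-Schwarz leaves a finite frame
  sum at \<open>w\<close>, at most \<open>D\<close> times the squared norm of \<open>w\<close>; one
  such square then cancels.\<close>

lemma bessel:
  assumes F: "finite F" "F \<subseteq> J"
  shows "(nrm (\<Sum>j\<in>F. act (b j) (x j)))\<^sup>2 \<le> D * norm (\<Sum>j\<in>F. b j * cstar (b j))"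
proof -
  define w where "w = (\<Sum>j\<in>F. act (b j) (x j))"
  define \<beta> where "\<beta> = norm (\<Sum>j\<in>F. b j * cstar (b j))"
  have "norm (\<Sum>j\<in>F. ip w (x j) * ip (x j) w) \<le> norm (D *\<^sub>R ip w w)"
    by (intro norm_mono_cle pos_elem_sum pos_frame_term cle_trans[OF cle_jsums[OF sums pos_frame_term F] upper])
  then have 1: "norm (\<Sum>j\<in>F. ip w (x j) * ip (x j) w) \<le> D * (nrm w)\<^sup>2"
    using D by (simp add: nrm_square)
  have "ip w w = ip (\<Sum>j\<in>F. act (b j) (x j)) w" by (simp only: w_def)
  also have "\<dots> = (\<Sum>j\<in>F. b j * cstar (ip w (x j)))" by (simp add: ip_sum_left ip_act_left ip_cstar)
  finally have "((nrm w)\<^sup>2)\<^sup>2 = (norm (\<Sum>j\<in>F. b j * cstar (ip w (x j))))\<^sup>2" by (simp add: nrm_square)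
  also have "\<dots> \<le> \<beta> * norm (\<Sum>j\<in>F. ip w (x j) * ip (x j) w)"
    using cauchy_schwarz_sum[of b "\<lambda>j. ip w (x j)" F] by (simp add: \<beta>_def ip_cstar)
  also have "\<dots> \<le> \<beta> * (D * (nrm w)\<^sup>2)" using 1 by (intro mult_left_mono) (simp_all add: \<beta>_def)
  finally have "(nrm w)\<^sup>2 * (nrm w)\<^sup>2 \<le> (D * \<beta>) * (nrm w)\<^sup>2" by (simp add: power2_eq_square mult_ac)
  moreover have "0 \<le> D * \<beta>" using D by (simp add: \<beta>_def)
  ultimately have "(nrm w)\<^sup>2 \<le> D * \<beta>"
    using mult_right_le_imp_le[of "(nrm w)\<^sup>2" "(nrm w)\<^sup>2" "D * \<beta>"] by (cases "nrm w = 0") simp_all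
  then show ?thesis by (simp only: w_def \<beta>_def)
qed

lemma synthesis_converges:
  assumes b: "b \<in> l2"
  shows "\<exists>L. hlim (\<lambda>n. \<Sum>j\<in>J \<inter> {..<n}. act (b j) (x j)) L"
  unfolding hlim_def
proof (rule complete, intro allI impI)
  fix e :: real assume e: "e > 0"
  define P where "P n = (\<Sum>j\<in>J \<inter> {..<n}. act (b j) (x j))" for n
  define c where "c n = (\<Sum>j<n. b j * cstar (b j))" for n
  have "Cauchy c" using b unfolding l2_def c_def by (auto intro: convergent_Cauchy)
  moreover have "e\<^sup>2 / D > 0" using e D by simp
  ultimately obtain N where N: "\<And>m n. m \<ge> N \<Longrightarrow> n \<ge> N \<Longrightarrow> norm (c m - c n) < e\<^sup>2 / D"
    using CauchyD by blast
  have lt: "nrm (P m - P n) < e" if mn: "n \<ge> N" "m \<ge> n" for m n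
  proof -
    have "(nrm (P m - P n))\<^sup>2 \<le> D * norm (\<Sum>j\<in>J \<inter> {n..<m}. b j * cstar (b j))"
      unfolding P_def sum_Int_lessThan_diff[OF mn(2)] by (rule bessel) auto
    \<comment> \<open>Membership in \<open>l2\<close> controls tails over all of \<open>nat\<close>;
      adding the positive terms outside \<open>J\<close> can only enlarge the norm.\<close>
    also have "\<dots> \<le> D * norm (\<Sum>j\<in>{n..<m}. b j * cstar (b j))"
    proof (intro mult_left_mono norm_mono_cle pos_elem_sum pos_elem_mult_star)
      have "(\<Sum>j\<in>{n..<m}. b j * cstar (b j)) - (\<Sum>j\<in>J \<inter> {n..<m}. b j * cstar (b j))
          = (\<Sum>j\<in>{n..<m} - J \<inter> {n..<m}. b j * cstar (b j))" by (subst sum_diff) auto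
      then show "cle (\<Sum>j\<in>J \<inter> {n..<m}. b j * cstar (b j)) (\<Sum>j\<in>{n..<m}. b j * cstar (b j))"
        unfolding cle_def by (simp only: pos_elem_sum pos_elem_mult_star)
    qed (use D in simp)
    also have "\<dots> = D * norm (c m - c n)"
      using sum_Int_lessThan_diff[OF mn(2), of "\<lambda>j. b j * cstar (b j)" UNIV] by (simp add: c_def)
    also have "\<dots> < D * (e\<^sup>2 / D)" using N[of m n] mn D by (intro mult_strict_left_mono) auto
    also have "\<dots> = e\<^sup>2" using D by simp
    finally show ?thesis using e by (simp add: power_less_imp_less_base)
  qed
  then have "nrm (P m - P n) < e" if "m \<ge> N" "n \<ge> N" for m n
    using that nrm_diff_commute[of "P m" "P n"] by (metis nle_le)
  then show "\<exists>N. \<forall>m\<ge>N. \<forall>n\<ge>N. nrm (P m - P n) < e" by blast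
qed

lemma sum_frame_transform:
  "(\<Sum>j<n. frame_transform ip J x v j * cstar (b j)) = (\<Sum>j\<in>J \<inter> {..<n}. ip v (x j) * cstar (b j))"
  by (rule sum.mono_neutral_cong_right) (auto simp: frame_transform_def)

lemma frame_transform_in_l2: "frame_transform ip J x v \<in> l2"
proof -
  have "(\<Sum>j<n. frame_transform ip J x v j * cstar (frame_transform ip J x v j))
      = (\<Sum>j\<in>J \<inter> {..<n}. ip v (x j) * ip (x j) v)" for n
    unfolding sum_frame_transform by (intro sum.cong) (auto simp: frame_transform_def ip_cstar)
  then show ?thesis using sums[of v] unfolding l2_def jsums_def convergent_def by auto
qed

text \<open>Outside \<open>l2\<close> the value may be arbitrary, since the adjoint relation is
  tested on \<open>l2\<close> only.\<close>

definition synthesis :: "(nat \<Rightarrow> 'a) \<Rightarrow> 'h" where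
  "synthesis b = (SOME L. hlim (\<lambda>n. \<Sum>j\<in>J \<inter> {..<n}. act (b j) (x j)) L)"

lemma hlim_synthesis: "b \<in> l2 \<Longrightarrow> hlim (\<lambda>n. \<Sum>j\<in>J \<inter> {..<n}. act (b j) (x j)) (synthesis b)"
  unfolding synthesis_def by (rule someI_ex) (rule synthesis_converges)

lemma transform_adjoint_synthesis: "is_transform_adjoint ip J x synthesis"
  unfolding is_transform_adjoint_def
proof (intro allI ballI)
  fix v b assume b: "b \<in> (l2 :: (nat \<Rightarrow> 'a) set)"
  have "(\<lambda>n. \<Sum>j<n. frame_transform ip J x v j * cstar (b j)) \<longlonglongrightarrow> ip v (synthesis b)"
    using hlim_ip[OF hlim_const[of v] hlim_synthesis[OF b]]
    by (simp add: sum_frame_transform ip_sum_right ip_act_right)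
  then show "l2_ip (frame_transform ip J x v) b = ip v (synthesis b)"
    unfolding l2_ip_def by (rule limI)
qed

definition S :: "'h \<Rightarrow> 'h" where
  "S v = synthesis (frame_transform ip J x v)"

lemma hlim_S: "hlim (\<lambda>n. \<Sum>j\<in>J \<inter> {..<n}. act (ip v (x j)) (x j)) (S v)"
proof -
  have "(\<Sum>j\<in>J \<inter> {..<n}. act (frame_transform ip J x v j) (x j)) = (\<Sum>j\<in>J \<inter> {..<n}. act (ip v (x j)) (x j))" for n
    by (intro sum.cong) (auto simp: frame_transform_def)
  then show ?thesis using hlim_synthesis[OF frame_transform_in_l2[of v]] by (simp add: S_def)
qed

lemma S_left: "(\<lambda>n. \<Sum>j\<in>J \<inter> {..<n}. ip v (x j) * ip (x j) w) \<longlonglongrightarrow> ip (S v) w"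
  using hlim_ip[OF hlim_S hlim_const[of w], of v] by (simp add: ip_sum_left ip_act_left)

lemma selfadj_S: "selfadj S"
  unfolding selfadj_def adjoint_of_def
proof (intro allI)
  fix v w
  have "(\<lambda>n. \<Sum>j\<in>J \<inter> {..<n}. ip v (x j) * ip (x j) w) \<longlonglongrightarrow> ip v (S w)"
    using hlim_ip[OF hlim_const[of v] hlim_S[of w]] by (simp add: ip_sum_right ip_act_right ip_cstar)
  then show "ip (S v) w = ip v (S w)" by (rule LIMSEQ_unique[OF S_left])
qed

lemma ip_S: "ip (S v) v = s v"
  using S_left[of v v] sums[of v] unfolding jsums_def by (rule LIMSEQ_unique)

section \<open>The square root of the frame operator and its consequences\<close>

lemma frame_sqrt:
  "\<exists>T R. selfadj T \<and> selfadj R \<and> bounded_op ip T \<and> bounded_op ip R \<and>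
    (\<forall>v. T (R v) = v) \<and> (\<forall>v. R (T v) = v) \<and> (\<forall>v. pos_elem (ip (T v) v)) \<and> (\<forall>v. T (T v) = S v)"
proof -
  \<comment> \<open>The operator \<open>S / M\<close> lies between \<open>C / M\<close> and
    \<open>D / M = 1 - C / M\<close>, so \<open>0 \<le> B \<le> q < 1\<close>. Using
    \<open>C + D\<close> rather than \<open>D\<close> gives \<open>q \<ge> 0\<close> without
    comparing \<open>C\<close> and \<open>D\<close>.\<close>
  define M where "M = C + D"
  have M: "M > 0" unfolding M_def using C D by simp
  define q where "q = 1 - C / M"
  have q: "0 \<le> q" "q < 1" unfolding q_def M_def using C D by (simp_all add: field_simps)
  define B where "B v = v - sc (1 / M) (S v)" for v
  have saB: "selfadj B"
    unfolding selfadj_def adjoint_of_def B_def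
    by (simp add: ip_diff_left ip_diff_right ip_sc_left ip_sc_right selfadjD[OF selfadj_S])
  have ipB: "ip (B v) v = ip v v - (1 / M) *\<^sub>R s v" for v
    by (simp add: B_def ip_diff_left ip_sc_left ip_S)
  have posB: "pos_elem (ip (B v) v)" for v
  proof -
    have "pos_elem ((1 / M) *\<^sub>R ((D *\<^sub>R ip v v - s v) + C *\<^sub>R ip v v))"
      using upper[of v] M C unfolding cle_def by (intro pos_elem_scaleR pos_elem_add pos_ip) auto
    moreover have "(D *\<^sub>R ip v v - s v) + C *\<^sub>R ip v v = M *\<^sub>R ip v v - s v"
      unfolding M_def by (simp add: scaleR_add_left)
    ultimately show ?thesis using M by (simp add: ipB scaleR_diff_right)
  qed
  have upB: "cle (ip (B v) v) (q *\<^sub>R ip v v)" for v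
  proof -
    have "pos_elem ((1 / M) *\<^sub>R (s v - C *\<^sub>R ip v v))"
      using lower[of v] M unfolding cle_def by (intro pos_elem_scaleR) auto
    then show ?thesis unfolding cle_def ipB q_def by (simp add: scaleR_diff_left scaleR_diff_right)
  qed
  have bB: "nrm (B v) \<le> q * nrm v" for v by (rule positive_form_bound[OF saB posB upB q(1)])
  obtain Y where Y: "selfadj Y" "\<And>v. nrm (Y v) \<le> q * nrm v" "\<And>v. (v - Y v) - Y (v - Y v) = v - B v"
    using op_sqrt_one_minus[OF saB bB q] by blast
  obtain Z where Z: "selfadj Z" "\<And>v. nrm (Z v) \<le> 1 / (1 - q) * nrm v"
      "\<And>v. Z (v - Y v) = v" "\<And>v. Z v - Y (Z v) = v"
    using op_one_minus_inverse[OF Y(1,2) q] by blast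
  have scsc: "sc a (sc b v) = sc (a * b) v" "sc 1 v = v" for a b v
    by (rule ip_ext, simp add: ip_sc_left)+
  define T where "T v = sc (sqrt M) (v - Y v)" for v
  define R where "R v = sc (1 / sqrt M) (Z v)" for v
  have linY: "Y (sc r v) = sc r (Y v)" for r v
    by (rule alinear_sc[OF adjoint_alinear[OF selfadjD[OF Y(1)]]])
  have linZ: "Z (sc r v) = sc r (Z v)" for r v
    by (rule alinear_sc[OF adjoint_alinear[OF selfadjD[OF Z(1)]]])
  show ?thesis
  proof (intro exI conjI allI)
    show "selfadj T" "selfadj R"
      unfolding selfadj_def adjoint_of_def T_def R_def
      by (simp_all add: ip_diff_left ip_diff_right ip_sc_left ip_sc_right selfadjD[OF Y(1)] selfadjD[OF Z(1)])
    have "nrm (T v) \<le> (sqrt M * (1 + q)) * nrm v" for v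
    proof -
      have "nrm (v - Y v) \<le> nrm v + nrm (Y v)"
        using nrm_diff_triangle[of v "Y v" 0] nrm_diff_commute[of 0 "Y v"] nrm_diff_triangle[of v 0 "Y v"] by simp
      then have "sqrt M * nrm (v - Y v) \<le> sqrt M * (nrm v + q * nrm v)"
        using Y(2)[of v] M by (intro mult_left_mono) auto
      then show ?thesis unfolding T_def using M by (simp add: nrm_sc algebra_simps)
    qed
    then show "bounded_op ip T" unfolding bounded_op_def by blast
    have "nrm (R v) \<le> (1 / sqrt M * (1 / (1 - q))) * nrm v" for v
    proof -
      have "1 / sqrt M * nrm (Z v) \<le> 1 / sqrt M * (1 / (1 - q) * nrm v)"
        using Z(2)[of v] M by (intro mult_left_mono) auto
      then show ?thesis unfolding R_def using M by (simp add: nrm_sc mult_ac)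
    qed
    then show "bounded_op ip R" unfolding bounded_op_def by blast
    show "T (R v) = v" for v
      unfolding T_def R_def linY using M by (simp add: sc_diff Z(4) scsc)
    show "R (T v) = v" for v
      unfolding T_def R_def linZ using M by (simp add: Z(3) scsc)
    \<comment> \<open>\<open>Y\<close> is itself a self-adjoint strict contraction, so
      \<open>1 - Y\<close> is positive like \<open>1 - B\<close>.\<close>
    show "pos_elem (ip (T v) v)" for v
      unfolding T_def ip_sc_left using M
      by (intro pos_elem_scaleR op_one_minus_pos[OF Y(1,2) q]) auto
    show "T (T v) = S v" for v
    proof -
      have "T (T v) = sc M ((v - Y v) - Y (v - Y v))"
        unfolding T_def linY using M by (simp add: sc_diff scsc)
      also have "\<dots> = sc M (sc (1 / M) (S v))" unfolding Y(3) B_def by simp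
      finally show ?thesis using M by (simp add: scsc)
    qed
  qed
qed

text \<open>The span indexes coefficients by vectors, so coefficients of repeated frame vectors must
  first be collected.\<close>

lemma partial_sum_in_span:
  assumes F: "finite F" "F \<subseteq> J"
  shows "(\<Sum>j\<in>F. act (b j) (x j)) \<in> alin_span act (x ` J)"
proof -
  have act_sum: "act (sum b G) z = (\<Sum>j\<in>G. act (b j) z)" if "finite G" for G z
    using that
  proof (induction G rule: finite_induct)
    case empty
    show ?case by (rule ip_ext) (simp add: ip_act_left)
  qed (simp add: act_add_left)
  have "(\<Sum>j\<in>F. act (b j) (x j)) = (\<Sum>i\<in>x ` F. \<Sum>j\<in>{j \<in> F. x j = i}. act (b j) (x j))"
    by (rule sum.image_gen[OF F(1)])
  also have "\<dots> = (\<Sum>i\<in>x ` F. act (\<Sum>j\<in>{j \<in> F. x j = i}. b j) i)"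
    using F(1) by (intro sum.cong refl) (simp add: act_sum)
  finally show ?thesis unfolding alin_span_def mem_Collect_eq
    using F by (intro exI[of _ "x ` F"] exI[of _ "\<lambda>i. \<Sum>j\<in>{j \<in> F. x j = i}. b j"]) auto
qed

text \<open>Each \<open>v\<close> equals \<open>S (R (R v))\<close>, and the partial sums of that
  series are finite combinations of frame vectors.\<close>

lemma frame_generates: "generates act ip (x ` J)"
  unfolding generates_def
proof (intro allI impI)
  fix v and e :: real assume e: "e > 0"
  obtain T R where TR: "\<forall>v. T (R v) = v" and TT: "\<forall>v. T (T v) = S v"
    using frame_sqrt by blast
  have "S (R (R v)) = v" by (simp only: TT[rule_format, symmetric] TR)
  then have "hlim (\<lambda>n. \<Sum>j\<in>J \<inter> {..<n}. act (ip (R (R v)) (x j)) (x j)) v"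
    using hlim_S[of "R (R v)"] by simp
  then obtain n where "nrm ((\<Sum>j\<in>J \<inter> {..<n}. act (ip (R (R v)) (x j)) (x j)) - v) < e"
    unfolding hlim_def using LIMSEQ_D[OF _ e] by fastforce
  moreover have "(\<Sum>j\<in>J \<inter> {..<n}. act (ip (R (R v)) (x j)) (x j)) \<in> alin_span act (x ` J)"
    by (rule partial_sum_in_span) auto
  ultimately show "\<exists>y\<in>alin_span act (x ` J). nrm (v - y) < e"
    using nrm_diff_commute by metis
qed

lemma frame_canonical_tight:
  "\<exists>y T \<theta>s. standard_nt_frame act ip J y \<and> invertible_op act ip T \<and> (\<forall>j\<in>J. x j = T (y j)) \<and>
    positive_op act ip T \<and> is_transform_adjoint ip J x \<theta>s \<and>
    (\<forall>v. T (T v) = \<theta>s (frame_transform ip J x v))"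
proof -
  obtain T R where sa: "selfadj T" "selfadj R" and bounded: "bounded_op ip T" "bounded_op ip R"
    and TR: "\<forall>v. T (R v) = v" "\<forall>v. R (T v) = v" and pos: "\<forall>v. pos_elem (ip (T v) v)"
    and TT: "\<forall>v. T (T v) = S v"
    using frame_sqrt by blast
  have good: "good_op act ip U" if "selfadj U" "bounded_op ip U" for U
    unfolding good_op_def adjointable_def
    using that adjoint_alinear[OF selfadjD[OF that(1)]] unfolding selfadj_def by blast
  have "standard_nt_frame act ip J (\<lambda>j. R (x j))"
    unfolding standard_nt_frame_def
  proof
    fix v
    \<comment> \<open>Moving one \<open>T\<close> across the inner product leaves
      \<open>T (R v) = v\<close> in both slots.\<close>
    have "s (R v) = ip (T (T (R v))) (R v)" by (simp only: TT ip_S)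
    also have "\<dots> = ip (T (R v)) (T (R v))" by (simp only: selfadjD[OF sa(1)])
    finally have "s (R v) = ip v v" by (simp only: TR(1))
    then show "jsums J (\<lambda>j. ip v (R (x j)) * ip (R (x j)) v) (ip v v)"
      using sums[of "R v"] by (simp add: selfadjD[OF sa(2)])
  qed
  moreover have "invertible_op act ip T"
    unfolding invertible_op_def using good[OF sa(1) bounded(1)] good[OF sa(2) bounded(2)] TR by blast
  moreover have "positive_op act ip T"
    unfolding positive_op_def using good[OF sa(1) bounded(1)] sa(1) pos unfolding selfadj_def by blast
  ultimately show ?thesis
    by (intro exI[of _ "\<lambda>j. R (x j)"] exI[of _ T] exI[of _ synthesis])
      (simp add: TR TT transform_adjoint_synthesis flip: S_def)
qed

end

theorem theorem5p3:
  fixes act :: "'a::cstar_algebra \<Rightarrow> 'h::ab_group_add \<Rightarrow> 'h"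
    and ip :: "'h \<Rightarrow> 'h \<Rightarrow> 'a"
    and J :: "nat set"
  assumes H: "hilbert_module act ip"
    and gen: "finitely_generated act \<or> countably_generated act ip"
  shows
    "(\<forall>x. standard_frame act ip J x \<longrightarrow>
        (\<exists>y T \<theta>s. standard_nt_frame act ip J y \<and> invertible_op act ip T \<and>
               (\<forall>j\<in>J. x j = T (y j)) \<and>
               positive_op act ip T \<and>
               is_transform_adjoint ip J x \<theta>s \<and>
               (\<forall>v. T (T v) = \<theta>s (frame_transform ip J x v)))) \<and>
     (\<forall>y T. standard_nt_frame act ip J y \<and> invertible_op act ip T \<longrightarrow>
        standard_frame act ip J (\<lambda>j. T (y j))) \<and>
     (\<forall>x. standard_frame act ip J x \<longrightarrow> generates act ip (x ` J))"
proof -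
  interpret hilbert_mod act ip by unfold_locales (rule H)
  have frameI: "\<exists>C D s. frame act ip J x C D s" if "standard_frame act ip J x" for x
  proof -
    obtain C D where CD: "C > 0" "D > 0" "\<And>v. \<exists>s. jsums J (\<lambda>j. ip v (x j) * ip (x j) v) s \<and>
        cle (C *\<^sub>R ip v v) s \<and> cle s (D *\<^sub>R ip v v)"
      using \<open>standard_frame act ip J x\<close> unfolding standard_frame_def by blast
    then obtain s where "\<And>v. jsums J (\<lambda>j. ip v (x j) * ip (x j) v) (s v) \<and>
        cle (C *\<^sub>R ip v v) (s v) \<and> cle (s v) (D *\<^sub>R ip v v)" by metis
    then have "frame act ip J x C D s" using CD by unfold_locales auto
    then show ?thesis by blast
  qed
  show ?thesis
  proof (intro conjI allI impI)
    fix x assume "standard_frame act ip J x"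
    then obtain C D s where "frame act ip J x C D s" using frameI by blast
    then interpret frame act ip J x C D s .
    show "\<exists>y T \<theta>s. standard_nt_frame act ip J y \<and> invertible_op act ip T \<and>
        (\<forall>j\<in>J. x j = T (y j)) \<and> positive_op act ip T \<and> is_transform_adjoint ip J x \<theta>s \<and>
        (\<forall>v. T (T v) = \<theta>s (frame_transform ip J x v))"
      by (rule frame_canonical_tight)
  next
    fix y T assume "standard_nt_frame act ip J y \<and> invertible_op act ip T"
    then show "standard_frame act ip J (\<lambda>j. T (y j))" using standard_frame_image by blast
  next
    fix x assume "standard_frame act ip J x"
    then obtain C D s where "frame act ip J x C D s" using frameI by blast
    then interpret frame act ip J x C D s .
    show "generates act ip (x ` J)" by (rule frame_generates)
  qed
qed

end
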